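(* Let $(\theta,act)\in\Lambda$ be an ABDF configuration (at time $0$) and let $\omega\in\Omega$. For $t_0\in\mathbb N$ set $$(\theta(t_0,\omega),act(t_0,\omega)):=\phi_{\mathrm{ABDF}}(t_0,\omega)(\theta,act),$$ the ABDF random dynamics. Write $MA^\pm_{t_0},A_{t_0},C_{t_0},MA^{\pm}_{iso,t_0}$ for the sets $MA^\pm,A,C,MA^\pm_{iso}$ evaluated at $(\theta(t_0,\omega),act(t_0,\omega),\omega,t_0)$, and $M^\pm_{t_0}=M^\pm(\theta(t_0,\omega))$ (see context). Define $u(t,x,\omega)$ for $t\in[0,\infty)$, $x\in\mathbb R$ as follows. For every $t_0\in\mathbb N$: 1. at $t=t_0$, $$u(t_0,x,\omega)=2\sum_{z\in M^+_{t_0}}1_{\{z\le x<z+\frac12\}}-2\sum_{z\in M^-_{t_0}}1_{\{z-\frac12\le x<z\}}+2\sum_{z\in A_{t_0}}\left(1_{\{z\le x<z+\frac12\}}-1_{\{z-\frac12\le x<z\}}\right);$$ 2. for $t\in[t_0,t_0+\frac12]$, $$u(t,x,\omega)=2\sum_{z\in MA^+_{t_0}}1_{\{z+(t-t_0)\le x<z+(t-t_0)+\frac12\}}-2\sum_{z'\in MA^-_{t_0}}1_{\{z'-(t-t_0)-\frac12\le x<z'-(t-t_0)\}};$$ 3. for $t\in[t_0+\frac12,t_0+1]$, $$\begin{aligned}u(t,x,\omega)=\;&2\sum_{z\in MA^+_{iso,t_0}}1_{\{z+(t-t_0)\le x<z+(t-t_0)+\frac12\}}-2\sum_{z'\in MA^-_{iso,t_0}}1_{\{z'-(t-t_0)-\frac12\le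 x<z'-(t-t_0)\}}\\&+2\sum_{x_0\in C_{t_0}}\left(1_{\{x_0-(t_0+1-t)\le x<x_0\}}-1_{\{x_0\le x<x_0+(t_0+1-t)\}}\right)\\&+2\sum_{x_0\in A_{t_0+1}}\left(1_{\{x_0\le x<x_0+(t-t_0-\frac12)\}}-1_{\{x_0-(t-t_0-\frac12)\le x<x_0\}}\right).\end{aligned}$$ Then $u(t,x,\omega)$ is a weak solution on $[0,\infty)$ (that is, on $[0,T]$ for every $T>0$) of Burgers' equation $\partial_tu+u\,\partial_xu=0$.
   Context: Here $\mathbb N=\{0,1,2,\dots\}$. For $x\in\mathbb Z$ let $alt_0(x)=x \bmod 2$ and $alt_1(x)=(x+1)\bmod 2$ (values in $\{0,1\}$). **The set $\Lambda_0$.** $\Lambda_0$ is the set of sequences $\theta:\mathbb Z\to\{-1,0,1\}$, not identically zero, such that: (i) if $x_1<x_2$ are integers with $\theta(x_1)\theta(x_2)=-1$ and $\theta(x)=0$ for all $x\in(x_1,x_2)\cap\mathbb Z$, then the cardinality of $(x_1,x_2)\cap\mathbb Z$ is odd; (ii) if $x_1<x_2$ are integers with $\theta(x_1)\theta(x_2)=1$ and $\theta(x)=0$ for all $x\in(x_1,x_2)\cap\mathbb Z$, then the cardinality of $(x_1,x_2)\cap\mathbb Z$ is even. **Activation record.** For $\theta\in\Lambda_0$, $ar(\theta):\mathbb Z\to\{0,1\}$ is defined by: (iii) if $\theta(x_0)\in\{-1,1\}$, then $ar(\theta)(x_0)=0$; (iv) if $\theta(x_0)=0$ and $L(x_0)=\{x<x_0:\theta(x)\in\{-1,1\}\}\ne\emptyset$,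 let $x_1=\max L(x_0)$, $k=x_0-x_1$, and $ar(\theta)(x_0)=\left|\frac{\theta(x_1)+(-1)^k}{2}\right|$; (v) if $\theta(x_0)=0$ and $R(x_0)=\{x>x_0:\theta(x)\in\{-1,1\}\}\ne\emptyset$, let $x_2=\min R(x_0)$, $h=x_2-x_0$, and $ar(\theta)(x_0)=\left|\frac{\theta(x_2)+(-1)^{h+1}}{2}\right|$. For $\theta\in\Lambda_0$ rules (iv) and (v) agree when both apply. To have an a priori definition, $ar(\theta)$ is given by the same rules for any $\theta\neq0$, using (iv) whenever it applies. **ABDF configurations.** $\Lambda$ is the set of maps $(\theta,act):\mathbb Z\to\{-1,0,1\}\times\{0,1\}$ such that either $\theta=0$ and $act\in\{alt_0,alt_1\}$, or $\theta\in\Lambda_0$ and $act=ar(\theta)$. **Noise.** $\Omega=\{0,1\}^{\mathbb N\times\mathbb Z}$, with the product $\sigma$-algebra and the product $P$ of Bernoulli($\frac12$) measures; $\omega(t,x)$ is the $(t,x)$-coordinate of $\omega$ and $\varkappa(t,x)=1-\omega(t,x)$. **ABDF dynamics.** The map $\mathcal T_{\mathrm{ABDF}}(t,\omega,\cdot)$ on $\Lambda$ (it maps $\Lambda$ into $\Lambda$) is defined for $t\ge1$ through its two components: $$\mathcal T_{\mathrm{ABDF}}(t,\omega,(\theta,act))_1(x)=\max(\theta(x-1),0)+act(x-1)\varkappa(t-1,x-1)+\min(\theta(x+1),0)-act(x+1)\varkappa(t-1,x+1).$$ If this first component is not identically zero, the second component is $ar$ of the first component. If the first component is identically zero, the second component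 equals $alt_1$ if at least one of the following holds: $\theta(0)=-1$; or $act(-1)=1$ and $\omega(t-1,-1)=1$; or $act(0)=1$ and $\omega(t-1,0)=0$; otherwise it equals $alt_0$. Then $\phi_{\mathrm{ABDF}}(0,\omega)=\mathrm{id}$ and $\phi_{\mathrm{ABDF}}(t,\omega)=\mathcal T_{\mathrm{ABDF}}(t,\omega,\cdot)\circ\cdots\circ\mathcal T_{\mathrm{ABDF}}(1,\omega,\cdot)$ for $t\ge1$. **Sets.** For $(\theta,act)\in\Lambda$, $\omega\in\Omega$, $t_0\in\mathbb N$: $M^+(\theta)=\{z\in\mathbb Z:\theta(z)=1\}$, $M^-(\theta)=\{z\in\mathbb Z:\theta(z)=-1\}$, $A(\theta,act,\omega,t_0)=\{z\in\mathbb Z:act(z)=1,\ \omega(t_0,z)=0\}$, $MA^{\pm}(\theta,act,\omega,t_0)=M^\pm(\theta)\cup A(\theta,act,\omega,t_0)$, $C(\theta,act,\omega,t_0)=\{z\in\mathbb Z: z-1\in MA^+(\theta,act,\omega,t_0),\ z+1\in MA^-(\theta,act,\omega,t_0)\}$, $MA^+_{iso}(\theta,act,\omega,t_0)=\{z\in MA^+(\theta,act,\omega,t_0): z+1\notin C(\theta,act,\omega,t_0)\}$, $MA^-_{iso}(\theta,act,\omega,t_0)=\{z\in MA^-(\theta,act,\omega,t_0): z-1\notin C(\theta,act,\omega,t_0)\}$. **Weak solution.** A bounded measurable function $u:[a,b]\times\mathbb R\to\mathbb R$ is a weak solution (of Burgers' equation) on $[a,b]$ if (i) for every smooth compactly supported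 $\varphi:\mathbb R\to\mathbb R$, the function $t\mapsto\int_{\mathbb R}u(t,x)\varphi(x)\,dx$ is continuous on $[a,b]$; (ii) for every smooth $\phi:\mathbb R^2\to\mathbb R$ with compact support in $(a,b)\times\mathbb R$, $\int_a^b\int_{\mathbb R}\left(u\,\partial_t\phi+\frac12u^2\,\partial_x\phi\right)dx\,dt=0$. No entropy condition is imposed. *)

theory Defs
  imports "HOL-Analysis.Analysis"
begin

text \<open>Fields on the integers and noises are integer valued; the ranges
  \<open>{-1,0,1}\<close> and \<open>{0,1}\<close> are imposed by the carrier sets \<open>Lambda0\<close>, \<open>Lambda\<close> and \<open>Omega\<close>.\<close>

type_synonym config = "(int \<Rightarrow> int) \<times> (int \<Rightarrow> int)"
type_synonym noise = "nat \<times> int \<Rightarrow> int"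

definition alt0 :: "int \<Rightarrow> int" where
  "alt0 x = x mod 2"

definition alt1 :: "int \<Rightarrow> int" where
  "alt1 x = (x + 1) mod 2"

definition Lambda0 :: "(int \<Rightarrow> int) set" where
  "Lambda0 = {\<theta>. (\<forall>x. \<theta> x \<in> {-1, 0, 1}) \<and> (\<exists>x. \<theta> x \<noteq> 0) \<and>
     (\<forall>x1 x2. x1 < x2 \<and> \<theta> x1 * \<theta> x2 = -1 \<and> (\<forall>x\<in>{x1<..<x2}. \<theta> x = 0)
        \<longrightarrow> odd (card {x1<..<x2})) \<and>
     (\<forall>x1 x2. x1 < x2 \<and> \<theta> x1 * \<theta> x2 = 1 \<and> (\<forall>x\<in>{x1<..<x2}. \<theta> x = 0)
        \<longrightarrow> even (card {x1<..<x2}))}"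

text \<open>The sets of particles to the left (right) may be infinite, so their maximum (minimum) is
  written with \<open>GREATEST\<close> (\<open>LEAST\<close>). The numerators below are \<open>-2\<close>, \<open>0\<close> or \<open>2\<close>,
  so the integer division is exact. If \<open>\<theta>\<close> is not identically zero, the last case is only
  reached when there is a particle to the right of \<open>x\<close>; the value for \<open>\<theta> = 0\<close> is
  meaningless and never used.\<close>

definition ar :: "(int \<Rightarrow> int) \<Rightarrow> int \<Rightarrow> int" where
  "ar \<theta> x =
    (if \<theta> x \<in> {-1, 1} then 0
     else if \<exists>y<x. \<theta> y \<in> {-1, 1} then
       let x1 = (GREATEST y. y < x \<and> \<theta> y \<in> {-1, 1}); k = nat (x - x1)
       in \<bar>(\<theta> x1 + (-1) ^ k) div 2\<bar>
     else
       let x2 = (LEAST y. y > x \<and> \<theta> y \<in> {-1, 1}); h = nat (x2 - x)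
       in \<bar>(\<theta> x2 + (-1) ^ (h + 1)) div 2\<bar>)"

definition Lambda :: "config set" where
  "Lambda = {(\<theta>, act). (\<theta> = (\<lambda>_. 0) \<and> act \<in> {alt0, alt1}) \<or> (\<theta> \<in> Lambda0 \<and> act = ar \<theta>)}"

definition Omega :: "noise set" where
  "Omega = {\<omega>. \<forall>t x. \<omega> (t, x) \<in> {0, 1}}"

definition kappa :: "noise \<Rightarrow> nat \<Rightarrow> int \<Rightarrow> int" where
  "kappa \<omega> t x = 1 - \<omega> (t, x)"

text \<open>The step with index \<open>t\<close> uses the noise at time \<open>t - 1\<close>; it is only used for \<open>t \<ge> 1\<close>.\<close>

definition T_ABDF1 :: "nat \<Rightarrow> noise \<Rightarrow> config \<Rightarrow> int \<Rightarrow> int" where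
  "T_ABDF1 t \<omega> = (\<lambda>(\<theta>, act) x.
     max (\<theta> (x - 1)) 0 + act (x - 1) * kappa \<omega> (t - 1) (x - 1)
     + min (\<theta> (x + 1)) 0 - act (x + 1) * kappa \<omega> (t - 1) (x + 1))"

definition T_ABDF2 :: "nat \<Rightarrow> noise \<Rightarrow> config \<Rightarrow> int \<Rightarrow> int" where
  "T_ABDF2 t \<omega> = (\<lambda>(\<theta>, act).
     if T_ABDF1 t \<omega> (\<theta>, act) \<noteq> (\<lambda>_. 0) then ar (T_ABDF1 t \<omega> (\<theta>, act))
     else if \<theta> 0 = -1 \<or> (act (-1) = 1 \<and> \<omega> (t - 1, -1) = 1) \<or> (act 0 = 1 \<and> \<omega> (t - 1, 0) = 0)
       then alt1
     else alt0)"

definition T_ABDF :: "nat \<Rightarrow> noise \<Rightarrow> config \<Rightarrow> config" where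
  "T_ABDF t \<omega> c = (T_ABDF1 t \<omega> c, T_ABDF2 t \<omega> c)"

primrec phi_ABDF :: "nat \<Rightarrow> noise \<Rightarrow> config \<Rightarrow> config" where
  "phi_ABDF 0 \<omega> = id"
| "phi_ABDF (Suc t) \<omega> = T_ABDF (Suc t) \<omega> \<circ> phi_ABDF t \<omega>"

definition M_plus :: "config \<Rightarrow> int set" where
  "M_plus c = {z. fst c z = 1}"

definition M_minus :: "config \<Rightarrow> int set" where
  "M_minus c = {z. fst c z = -1}"

definition A_set :: "config \<Rightarrow> noise \<Rightarrow> nat \<Rightarrow> int set" where
  "A_set c \<omega> t0 = {z. snd c z = 1 \<and> \<omega> (t0, z) = 0}"

definition MA_plus :: "config \<Rightarrow> noise \<Rightarrow> nat \<Rightarrow> int set" where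
  "MA_plus c \<omega> t0 = M_plus c \<union> A_set c \<omega> t0"

definition MA_minus :: "config \<Rightarrow> noise \<Rightarrow> nat \<Rightarrow> int set" where
  "MA_minus c \<omega> t0 = M_minus c \<union> A_set c \<omega> t0"

definition C_set :: "config \<Rightarrow> noise \<Rightarrow> nat \<Rightarrow> int set" where
  "C_set c \<omega> t0 = {z. z - 1 \<in> MA_plus c \<omega> t0 \<and> z + 1 \<in> MA_minus c \<omega> t0}"

definition MA_plus_iso :: "config \<Rightarrow> noise \<Rightarrow> nat \<Rightarrow> int set" where
  "MA_plus_iso c \<omega> t0 = {z \<in> MA_plus c \<omega> t0. z + 1 \<notin> C_set c \<omega> t0}"

definition MA_minus_iso :: "config \<Rightarrow> noise \<Rightarrow> nat \<Rightarrow> int set" where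
  "MA_minus_iso c \<omega> t0 = {z \<in> MA_minus c \<omega> t0. z - 1 \<notin> C_set c \<omega> t0}"

text \<open>The index sets may be infinite, but for fixed \<open>t\<close> and \<open>x\<close> only finitely many terms of each
  sum are nonzero, so \<open>infsum\<close> is the ordinary sum. In the three formulas, \<open>c\<close> is the initial
  configuration.\<close>

definition u_integer_time :: "config \<Rightarrow> noise \<Rightarrow> nat \<Rightarrow> real \<Rightarrow> real" where
  "u_integer_time c \<omega> t0 x = (let c0 = phi_ABDF t0 \<omega> c in
     2 * (\<Sum>\<^sub>\<infinity>z\<in>M_plus c0. indicator {of_int z ..< of_int z + 1/2} x)
     - 2 * (\<Sum>\<^sub>\<infinity>z\<in>M_minus c0. indicator {of_int z - 1/2 ..< of_int z} x)
     + 2 * (\<Sum>\<^sub>\<infinity>z\<in>A_set c0 \<omega> t0.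
              indicator {of_int z ..< of_int z + 1/2} x - indicator {of_int z - 1/2 ..< of_int z} x))"

definition u_first_half :: "config \<Rightarrow> noise \<Rightarrow> nat \<Rightarrow> real \<Rightarrow> real \<Rightarrow> real" where
  "u_first_half c \<omega> t0 t x = (let c0 = phi_ABDF t0 \<omega> c; s = t - real t0 in
     2 * (\<Sum>\<^sub>\<infinity>z\<in>MA_plus c0 \<omega> t0. indicator {of_int z + s ..< of_int z + s + 1/2} x)
     - 2 * (\<Sum>\<^sub>\<infinity>z\<in>MA_minus c0 \<omega> t0. indicator {of_int z - s - 1/2 ..< of_int z - s} x))"

definition u_second_half :: "config \<Rightarrow> noise \<Rightarrow> nat \<Rightarrow> real \<Rightarrow> real \<Rightarrow> real" where
  "u_second_half c \<omega> t0 t x =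
    (let c0 = phi_ABDF t0 \<omega> c; c1 = phi_ABDF (t0 + 1) \<omega> c;
         s = t - real t0; r = real t0 + 1 - t in
     2 * (\<Sum>\<^sub>\<infinity>z\<in>MA_plus_iso c0 \<omega> t0. indicator {of_int z + s ..< of_int z + s + 1/2} x)
     - 2 * (\<Sum>\<^sub>\<infinity>z\<in>MA_minus_iso c0 \<omega> t0. indicator {of_int z - s - 1/2 ..< of_int z - s} x)
     + 2 * (\<Sum>\<^sub>\<infinity>x0\<in>C_set c0 \<omega> t0.
              indicator {of_int x0 - r ..< of_int x0} x - indicator {of_int x0 ..< of_int x0 + r} x)
     + 2 * (\<Sum>\<^sub>\<infinity>x0\<in>A_set c1 \<omega> (t0 + 1).
              indicator {of_int x0 ..< of_int x0 + (s - 1/2)} x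
              - indicator {of_int x0 - (s - 1/2) ..< of_int x0} x))"

text \<open>The defining rules of \<open>u\<close>; they overlap at integer and half-integer times, and constrain
  \<open>u\<close> at times \<open>t \<ge> 0\<close> only.\<close>

definition is_ABDF_field :: "config \<Rightarrow> noise \<Rightarrow> (real \<Rightarrow> real \<Rightarrow> real) \<Rightarrow> bool" where
  "is_ABDF_field c \<omega> u \<longleftrightarrow> (\<forall>t0::nat. \<forall>x.
     u (real t0) x = u_integer_time c \<omega> t0 x \<and>
     (\<forall>t\<in>{real t0 .. real t0 + 1/2}. u t x = u_first_half c \<omega> t0 t x) \<and>
     (\<forall>t\<in>{real t0 + 1/2 .. real t0 + 1}. u t x = u_second_half c \<omega> t0 t x))"

text \<open>Functions of class \<open>C^k\<close>: all iterated directional derivatives up to order \<open>k\<close> exist (as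
  values of Frechet derivatives) and are continuous.\<close>

primrec Ck :: "nat \<Rightarrow> ('a::euclidean_space \<Rightarrow> real) \<Rightarrow> bool" where
  "Ck 0 f \<longleftrightarrow> continuous_on UNIV f"
| "Ck (Suc k) f \<longleftrightarrow> (\<forall>x. f differentiable (at x)) \<and>
     (\<forall>v. Ck k (\<lambda>x. frechet_derivative f (at x) v))"

definition smooth :: "('a::euclidean_space \<Rightarrow> real) \<Rightarrow> bool" where
  "smooth f \<longleftrightarrow> (\<forall>k. Ck k f)"

definition supp :: "('a::euclidean_space \<Rightarrow> real) \<Rightarrow> 'a set" where
  "supp f = closure {x. f x \<noteq> 0}"

definition weak_solution :: "real \<Rightarrow> real \<Rightarrow> (real \<Rightarrow> real \<Rightarrow> real) \<Rightarrow> bool" where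
  "weak_solution a b u \<longleftrightarrow>
     bounded ((\<lambda>(t, x). u t x) ` ({a..b} \<times> UNIV)) \<and>
     (\<lambda>(t, x). u t x) \<in> borel_measurable (restrict_space borel ({a..b} \<times> UNIV)) \<and>
     (\<forall>f::real \<Rightarrow> real. smooth f \<and> compact (supp f) \<longrightarrow>
        continuous_on {a..b} (\<lambda>t. LINT x|lborel. u t x * f x)) \<and>
     (\<forall>g::real \<times> real \<Rightarrow> real. smooth g \<and> compact (supp g) \<and> supp g \<subseteq> {a<..<b} \<times> UNIV \<longrightarrow>
        (LINT t:{a..b}|lborel. (LINT x|lborel.
           u t x * deriv (\<lambda>s. g (s, x)) t + 1/2 * (u t x)\<^sup>2 * deriv (\<lambda>y. g (t, y)) x)) = 0)"

end

theory Submission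
  imports Defs
begin

text \<open>An ABDF configuration is the same as an arbitrary sequence of bits on the bonds of the integers:
  a site with neighbouring bonds \<open>(0, 0)\<close> carries a positive particle, \<open>(1, 1)\<close> a negative one,
  \<open>(1, 0)\<close> is active and \<open>(0, 1)\<close> is inactive. A bond with bit \<open>0\<close> can only be crossed by a positive
  particle, a bond with bit \<open>1\<close> only by a negative one. Hence during a first half step every bond contains
  at most one particle, and during a second half step the neighbourhood of every site contains either one
  particle, or a collision, or a creation, or nothing.

  In each of these cases the field is, locally, a finite sum of steps \<open>w * 1{x < p + v * t}\<close>, and the
  Rankine-Hugoniot condition says that half its square is the sum of \<open>w * v * 1{x < p + v * t}\<close>. The weak
  formulation is thus linear in the steps, and reduces to the transport of one step, whatever the entropy
  condition. Summing over the half steps, the boundary terms telescope.\<close>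

subsection \<open>Configurations as bond sequences\<close>

text \<open>The bond \<open>b x\<close> joins the sites \<open>x - 1\<close> and \<open>x\<close>; site \<open>x\<close> sees \<open>b x\<close> on its left and
  \<open>b (x + 1)\<close> on its right.\<close>

definition bond_rep :: "(int \<Rightarrow> bool) \<Rightarrow> config \<Rightarrow> bool" where
  "bond_rep b c \<longleftrightarrow> (\<forall>x.
     fst c x = (if b x = b (x + 1) then if b x then -1 else 1 else 0) \<and>
     snd c x = of_bool (b x \<and> \<not> b (x + 1)))"

section \<open>Activation records and parity along gaps\<close>

lemma ar_nonzero: "\<theta> x \<in> {-1, 1} \<Longrightarrow> ar \<theta> x = 0"
  by (simp add: ar_def)

text \<open>The numerator in \<open>ar\<close> is nonzero exactly when the sign of the particle
  equals \<open>(-1)^k\<close>, so the value is a parity condition on the distance. This form can be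
  compared with alternating bits.\<close>

lemma ar_left:
  assumes "\<theta> x = 0" "x1 < x" "\<theta> x1 \<in> {-1, 1}" "\<And>y. x1 < y \<Longrightarrow> y < x \<Longrightarrow> \<theta> y = 0"
  shows "ar \<theta> x = of_bool ((\<theta> x1 = 1) = even (x - x1))"
proof -
  have G: "(GREATEST y. y < x \<and> \<theta> y \<in> {-1, 1}) = x1"
  proof (rule Greatest_equality)
    show "y \<le> x1" if "y < x \<and> \<theta> y \<in> {-1, 1}" for y
      using assms(4)[of y] that by (cases "x1 < y") auto
  qed (use assms in auto)
  have "ar \<theta> x = \<bar>(\<theta> x1 + (-1) ^ nat (x - x1)) div 2\<bar>"
    using assms G unfolding ar_def Let_def by auto
  moreover have "even (nat (x - x1)) = even (x - x1)"
    using assms(2) by (simp add: even_nat_iff)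
  ultimately show ?thesis
    using assms(3) by (cases "even (x - x1)") auto
qed

text \<open>The parity is reversed because the exponent is \<open>h + 1\<close>. Particles to the
  left are excluded because \<open>ar\<close> gives precedence to them.\<close>

lemma ar_right:
  assumes "\<theta> x = 0" "\<not> (\<exists>y<x. \<theta> y \<in> {-1, 1})" "x < x2" "\<theta> x2 \<in> {-1, 1}"
    "\<And>y. x < y \<Longrightarrow> y < x2 \<Longrightarrow> \<theta> y = 0"
  shows "ar \<theta> x = of_bool ((\<theta> x2 = 1) = odd (x2 - x))"
proof -
  have L: "(LEAST y. y > x \<and> \<theta> y \<in> {-1, 1}) = x2"
  proof (rule Least_equality)
    show "x2 \<le> y" if "y > x \<and> \<theta> y \<in> {-1, 1}" for y
      using assms(5)[of y] that by (cases "y < x2") auto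
  qed (use assms in auto)
  have "ar \<theta> x = \<bar>(\<theta> x2 + (-1) ^ (nat (x2 - x) + 1)) div 2\<bar>"
    using assms L unfolding ar_def Let_def by auto
  moreover have "even (nat (x2 - x)) = even (x2 - x)"
    using assms(3) by (simp add: even_nat_iff)
  ultimately show ?thesis
    using assms(4) by (cases "even (x2 - x)") auto
qed

text \<open>The candidates may be unbounded below, so the maximum is taken over the finite window
  from one witness to \<open>x\<close>.\<close>

lemma last_before:
  fixes x :: int
  assumes "\<exists>y<x. P y"
  shows "\<exists>x1<x. P x1 \<and> (\<forall>y. x1 < y \<and> y < x \<longrightarrow> \<not> P y)"
proof -
  obtain y0 where y0: "y0 < x" "P y0" using assms by blast
  let ?S = "{y \<in> {y0..<x}. P y}"
  have "finite ?S" by (rule finite_subset[of _ "{y0..<x}"]) auto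
  moreover have "?S \<noteq> {}" using y0 by auto
  moreover define m where "m = Max ?S"
  ultimately have m: "m \<in> ?S" "\<And>y. y \<in> ?S \<Longrightarrow> y \<le> m"
    using Max_in[of ?S] Max_ge[of ?S] by simp_all
  then have "\<not> P y" if "m < y" "y < x" for y using that m(1) m(2)[of y] by fastforce
  then show ?thesis using m(1) by auto
qed

lemma first_after:
  fixes x :: int
  assumes "\<exists>y>x. P y"
  shows "\<exists>x2>x. P x2 \<and> (\<forall>y. x < y \<and> y < x2 \<longrightarrow> \<not> P y)"
proof -
  obtain y0 where y0: "x < y0" "P y0" using assms by blast
  let ?S = "{y \<in> {x<..y0}. P y}"
  have "finite ?S" by (rule finite_subset[of _ "{x<..y0}"]) auto
  moreover have "?S \<noteq> {}" using y0 by auto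
  moreover define m where "m = Min ?S"
  ultimately have m: "m \<in> ?S" "\<And>y. y \<in> ?S \<Longrightarrow> m \<le> y"
    using Min_in[of ?S] Min_le[of ?S] by simp_all
  then have "\<not> P y" if "x < y" "y < m" for y using that m(1) m(2)[of y] by fastforce
  then show ?thesis using m(1) by auto
qed

text \<open>Across a run of empty sites the bit flips at each site, so only the parity of the length
  matters. This links bits with the parity rules for particles.\<close>

lemma alternating_iff:
  fixes b :: "int \<Rightarrow> bool"
  assumes "m \<le> n" "\<And>y. m \<le> y \<Longrightarrow> y < n \<Longrightarrow> b y \<noteq> b (y + 1)"
  shows "b n = (b m = even (n - m))"
  using assms
proof (induction n rule: int_ge_induct)
  case base then show ?case by simp
next
  case (step i)
  have "b i = (b m = even (i - m))" using step.IH step.prems by auto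
  moreover have "b i \<noteq> b (i + 1)" using step by auto
  ultimately show ?case by (auto simp: even_diff)
qed

text \<open>Between \<open>x\<close> and the nearest particle the bits alternate, so the bit next to
  that particle and the parity of the distance fix \<open>b x\<close>, which is what
  \<open>ar\<close> computes from either side.\<close>

lemma ar_bond:
  assumes \<theta>: "\<And>x. \<theta> x = (if b x = b (x + 1) then if b x then -1 else 1 else (0::int))"
    and nz: "\<theta> \<noteq> (\<lambda>_. 0)"
  shows "ar \<theta> x = of_bool (b x \<and> \<not> b (x + 1))"
proof -
  have alt: "b y \<noteq> b (y + 1)" if "\<theta> y = 0" for y
    using that \<theta>[of y] by (auto split: if_splits)
  show ?thesis
  proof (cases "\<theta> x = 0")
    case False
    then show ?thesis using \<theta>[of x] ar_nonzero[of \<theta> x] by (auto split: if_splits)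
  next
    case 0: True
    then have bx: "b (x + 1) = (\<not> b x)" using \<theta>[of x] by (auto split: if_splits)
    show ?thesis
    proof (cases "\<exists>y<x. \<theta> y \<in> {-1, 1}")
      case True
      obtain x1 where x1: "x1 < x" "\<theta> x1 \<in> {-1, 1}" "\<And>y. x1 < y \<Longrightarrow> y < x \<Longrightarrow> \<theta> y \<notin> {-1, 1}"
        using last_before[OF True] by blast
      have z: "\<theta> y = 0" if "x1 < y" "y < x" for y
        using x1(3)[OF that] \<theta>[of y] by (auto split: if_splits)
      have "b x = (b (x1 + 1) = even (x - (x1 + 1)))"
        using x1(1) z alt by (intro alternating_iff) auto
      moreover have "b (x1 + 1) = (\<theta> x1 \<noteq> 1)"
        using x1(2) \<theta>[of x1] by (auto split: if_splits)
      ultimately show ?thesis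
        using ar_left[OF 0 x1(1,2) z] bx by auto
    next
      case False
      obtain y where y: "\<theta> y \<noteq> 0" using nz by auto
      then have y1: "\<theta> y \<in> {-1, 1}" using \<theta>[of y] by (auto split: if_splits)
      moreover from this have "\<not> y < x" using False by blast
      moreover have "y \<noteq> x" using y 0 by blast
      ultimately have "y > x" by simp
      then have right: "\<exists>y>x. \<theta> y \<in> {-1, 1}" using y1 by blast
      obtain x2 where x2: "x < x2" "\<theta> x2 \<in> {-1, 1}" "\<And>y. x < y \<Longrightarrow> y < x2 \<Longrightarrow> \<theta> y \<notin> {-1, 1}"
        using first_after[OF right] by blast
      have z: "\<theta> y = 0" if "x < y" "y < x2" for y
        using x2(3)[OF that] \<theta>[of y] by (auto split: if_splits)
      have "b x2 = (b (x + 1) = even (x2 - (x + 1)))"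
        using x2(1) z alt by (intro alternating_iff) auto
      moreover have "b x2 = (\<theta> x2 \<noteq> 1)"
        using x2(2) \<theta>[of x2] by (auto split: if_splits)
      ultimately show ?thesis
        using ar_right[OF 0 False x2(1,2) z] bx by auto
    qed
  qed
qed

text \<open>Each site prescribes the bits on both its sides; the point is that neighbours agree
  about their common bond. They do so by the rules for \<open>ar\<close> or, when a gap closes
  between two particles, by the parity conditions of \<open>Lambda0\<close>.\<close>

lemma Lambda0_bond:
  assumes "\<theta> \<in> Lambda0"
  shows "\<exists>b. bond_rep b (\<theta>, ar \<theta>)"
proof -
  \<comment> \<open>\<open>b x\<close> is read from the site on its right: the bit patterns starting
    with 1 belong to negative particles and to active sites.\<close>
  define b where "b x \<longleftrightarrow> \<theta> x = -1 \<or> \<theta> x = 0 \<and> ar \<theta> x = 1" for x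
  have rng: "\<theta> x \<in> {-1, 0, 1}" for x
    using assms by (auto simp: Lambda0_def)
  have nz: "\<exists>x. \<theta> x \<noteq> 0" using assms by (auto simp: Lambda0_def)
  \<comment> \<open>An open gap contains \<open>x2 - x1 - 1\<close> integers, so both parity
    conditions merge into one on the distance, with reversed parity.\<close>
  have gap: "(\<theta> x1 = \<theta> x2) = odd (x2 - x1)"
    if "x1 < x2" "\<theta> x1 \<noteq> 0" "\<theta> x2 \<noteq> 0" "\<And>y. x1 < y \<Longrightarrow> y < x2 \<Longrightarrow> \<theta> y = 0" for x1 x2
  proof -
    have z: "\<forall>x\<in>{x1<..<x2}. \<theta> x = 0" using that(4) by auto
    have "odd (card {x1<..<x2})" if "\<theta> x1 * \<theta> x2 = -1"
      using assms \<open>x1 < x2\<close> that z unfolding Lambda0_def mem_Collect_eq by blast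
    moreover have "even (card {x1<..<x2})" if "\<theta> x1 * \<theta> x2 = 1"
      using assms \<open>x1 < x2\<close> that z unfolding Lambda0_def mem_Collect_eq by blast
    moreover have "even (card {x1<..<x2}) = odd (x2 - x1)"
      using that(1) by (simp add: even_nat_iff)
    moreover have "\<theta> x1 * \<theta> x2 = (if \<theta> x1 = \<theta> x2 then 1 else -1)"
      using that(2,3) rng[of x1] rng[of x2] by auto
    ultimately show ?thesis by (auto split: if_splits)
  qed
  \<comment> \<open>The right-hand side is the bit that site \<open>x\<close> predicts for the bond
    to its right: 1 for a negative particle, the flipped bit for an empty site.\<close>
  have step: "b (x + 1) = (\<theta> x = -1 \<or> \<theta> x = 0 \<and> \<not> b x)" for x
  proof (cases "\<theta> x = 0")
    case False
    then have x: "\<theta> x \<in> {-1, 1}" using rng[of x] by auto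
    show ?thesis
    proof (cases "\<theta> (x + 1) = 0")
      case True
      then have "ar \<theta> (x + 1) = of_bool ((\<theta> x = 1) = even (x + 1 - x))"
        using x by (intro ar_left) auto
      then show ?thesis using x True by (auto simp: b_def)
    next
      case n: False
      have "\<theta> x = \<theta> (x + 1)" using gap[of x "x + 1"] False n by auto
      then show ?thesis using x by (auto simp: b_def)
    qed
  next
    case 0: True
    show ?thesis
    proof (cases "\<exists>y<x. \<theta> y \<in> {-1, 1}")
      case True
      obtain x1 where x1: "x1 < x" "\<theta> x1 \<in> {-1, 1}" "\<And>y. x1 < y \<Longrightarrow> y < x \<Longrightarrow> \<theta> y \<notin> {-1, 1}"
        using last_before[OF True] by blast
      have z: "\<theta> y = 0" if "x1 < y" "y < x" for y
        using x1(3)[OF that] rng[of y] by auto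
      have z': "\<theta> y = 0" if "x1 < y" "y < x + 1" for y
        using z[of y] that 0 by (cases "y = x") auto
      have ax: "ar \<theta> x = of_bool ((\<theta> x1 = 1) = even (x - x1))"
        using ar_left[OF 0 x1(1,2) z] .
      show ?thesis
      proof (cases "\<theta> (x + 1) = 0")
        case 1: True
        have "ar \<theta> (x + 1) = of_bool ((\<theta> x1 = 1) = even (x + 1 - x1))"
          using x1 z' 1 by (intro ar_left) auto
        then show ?thesis using ax 0 1 by (auto simp: b_def)
      next
        case False
        have "(\<theta> x1 = \<theta> (x + 1)) = odd (x + 1 - x1)"
          using x1 z' False by (intro gap) auto
        then show ?thesis using ax 0 False rng[of "x + 1"] x1(2) by (auto simp: b_def)
      qed
    next
      case no: False
      then have no': "\<not> (\<exists>y<x + 1. \<theta> y \<in> {-1, 1})"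
        using 0 unfolding zless_add1_eq by fastforce
      show ?thesis
      proof (cases "\<theta> (x + 1) = 0")
        case False
        then have t: "\<theta> (x + 1) \<in> {-1, 1}" using rng[of "x + 1"] by auto
        then have "ar \<theta> x = of_bool ((\<theta> (x + 1) = 1) = odd (x + 1 - x))"
          using 0 no by (intro ar_right) auto
        then show ?thesis using t 0 by (auto simp: b_def)
      next
        case 1: True
        obtain y where y: "\<theta> y \<in> {-1, 1}" using nz rng by blast
        then have "\<not> y < x + 1" using no' by blast
        moreover have "y \<noteq> x + 1" using y 1 by auto
        ultimately have "y > x + 1" by simp
        then have right: "\<exists>y>x + 1. \<theta> y \<in> {-1, 1}" using y by blast
        obtain x2 where x2: "x + 1 < x2" "\<theta> x2 \<in> {-1, 1}"
            "\<And>y. x + 1 < y \<Longrightarrow> y < x2 \<Longrightarrow> \<theta> y \<notin> {-1, 1}"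
          using first_after[OF right] by blast
        have z: "\<theta> y = 0" if "x + 1 < y" "y < x2" for y
          using x2(3)[OF that] rng[of y] by auto
        have z': "\<theta> y = 0" if "x < y" "y < x2" for y
          using z[of y] that 1 by (cases "y = x + 1") auto
        have "ar \<theta> (x + 1) = of_bool ((\<theta> x2 = 1) = odd (x2 - (x + 1)))"
          using ar_right[OF 1 no' x2(1,2) z] .
        moreover have "ar \<theta> x = of_bool ((\<theta> x2 = 1) = odd (x2 - x))"
          using 0 no x2 z' by (intro ar_right) auto
        ultimately show ?thesis using 0 1 by (auto simp: b_def)
      qed
    qed
  qed
  have "\<theta> x = (if b x = b (x + 1) then if b x then -1 else 1 else 0)" for x
    using rng[of x] step[of x] by (auto simp: b_def)
  then have "bond_rep b (\<theta>, ar \<theta>)"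
    using ar_bond[of \<theta> b] nz unfolding bond_rep_def by fastforce
  then show ?thesis by blast
qed

text \<open>Without particles every site flips the bit, which leaves the two alternating sequences,
  one for \<open>alt0\<close> and one for \<open>alt1\<close>.\<close>

lemma Lambda_bond:
  assumes "c \<in> Lambda"
  shows "\<exists>b. bond_rep b c"
proof -
  obtain \<theta> act where c: "c = (\<theta>, act)" by (cases c)
  have "\<theta> = (\<lambda>_. 0) \<and> (act = alt0 \<or> act = alt1) \<or> \<theta> \<in> Lambda0 \<and> act = ar \<theta>"
    using assms unfolding Lambda_def c mem_Collect_eq prod.case insert_iff empty_iff by simp
  then consider "\<theta> = (\<lambda>_. 0)" "act = alt0" | "\<theta> = (\<lambda>_. 0)" "act = alt1" | "\<theta> \<in> Lambda0" "act = ar \<theta>"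
    by argo
  then show ?thesis
  proof cases
    case 1
    then have "bond_rep (\<lambda>x. odd x) c"
      unfolding c bond_rep_def by (simp add: alt0_def mod2_eq_if)
    then show ?thesis by (rule exI[of "\<lambda>b. bond_rep b c"])
  next
    case 2
    then have "bond_rep (\<lambda>x. even x) c"
      unfolding c bond_rep_def by (simp add: alt1_def mod2_eq_if)
    then show ?thesis by (rule exI[of "\<lambda>b. bond_rep b c"])
  next
    case 3
    show ?thesis unfolding c 3(2) by (rule Lambda0_bond[OF 3(1)])
  qed
qed

text \<open>The dynamics flips \<open>(1, 0)\<close> to \<open>(0, 1)\<close> at the active sites that do not emit.\<close>

definition bond_step :: "(int \<Rightarrow> int) \<Rightarrow> (int \<Rightarrow> bool) \<Rightarrow> int \<Rightarrow> bool" where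
  "bond_step e b x \<longleftrightarrow>
     (if b x then \<not> (\<not> b (x + 1) \<and> e x = 1) else b (x - 1) \<and> e (x - 1) = 1)"

section \<open>One time step of the dynamics on bonds\<close>

lemma alternating_everywhere:
  fixes b :: "int \<Rightarrow> bool"
  assumes "\<And>y. b y \<noteq> b (y + 1)"
  shows "b x = (b 0 = even x)"
proof (cases "0 \<le> x")
  case True
  from alternating_iff[where b = b, OF this assms] show ?thesis by simp
next
  case False
  then have "x \<le> 0" by simp
  from alternating_iff[where b = b, OF this assms] show ?thesis by auto
qed

text \<open>The new field depends on finitely many bits and noise values, a finite check, and the
  new activity then follows from \<open>ar_bond\<close>. If the new field vanishes, a choice
  remains, which the bit of bond 0 settles.\<close>

lemma bond_rep_T:
  assumes b: "bond_rep b c" and \<omega>: "\<omega> \<in> Omega"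
  shows "bond_rep (bond_step (\<lambda>x. \<omega> (t, x)) b) (T_ABDF (Suc t) \<omega> c)"
proof -
  let ?b = "bond_step (\<lambda>x. \<omega> (t, x)) b"
  let ?\<theta> = "T_ABDF1 (Suc t) \<omega> c"
  obtain \<theta> act where c: "c = (\<theta>, act)" by (cases c)
  have om: "\<omega> (t, x) = 0 \<or> \<omega> (t, x) = 1" for x
    using \<omega> by (auto simp: Omega_def)
  have th: "\<theta> x = (if b x = b (x + 1) then if b x then -1 else 1 else 0)"
    and ac: "act x = of_bool (b x \<and> \<not> b (x + 1))" for x
    using b by (auto simp: bond_rep_def c)
  \<comment> \<open>Emission at \<open>x\<close> does not enter the new field at \<open>x\<close>,
    but the noise there affects both new bits around \<open>x\<close>; hence three noise values are
    split.\<close>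
  have 1: "?\<theta> x = (if ?b x = ?b (x + 1) then if ?b x then -1 else 1 else 0)" for x
    by (cases "b (x - 1)"; cases "b x"; cases "b (x + 1)"; cases "b (x + 1 + 1)";
        rule disjE[OF om[of "x - 1"]]; rule disjE[OF om[of x]]; rule disjE[OF om[of "x + 1"]];
        simp add: T_ABDF1_def c th ac bond_step_def kappa_def)
  have 2: "T_ABDF2 (Suc t) \<omega> c x = of_bool (?b x \<and> \<not> ?b (x + 1))" for x
  proof (cases "?\<theta> = (\<lambda>_. 0)")
    case False
    then have "T_ABDF2 (Suc t) \<omega> c = ar ?\<theta>"
      unfolding T_ABDF2_def c by simp
    then show ?thesis using ar_bond[of ?\<theta> ?b x] 1 False by simp
  next
    case True
    have alt: "?b y \<noteq> ?b (y + 1)" for y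
      using 1[of y] fun_cong[OF True, of y] by (auto split: if_splits)
    then have "?b x = (?b 0 = even x)" by (rule alternating_everywhere)
    \<comment> \<open>The condition by which the dynamics chooses \<open>alt1\<close> over
      \<open>alt0\<close> says exactly that bond 0 has the new bit 1.\<close>
    moreover have "?b 0 \<longleftrightarrow> \<theta> 0 = -1 \<or> (act (-1) = 1 \<and> \<omega> (t, -1) = 1) \<or> (act 0 = 1 \<and> \<omega> (t, 0) = 0)"
      using om[of 0] by (cases "b 0"; cases "b 1"; cases "b (-1)") (auto simp: th ac bond_step_def)
    moreover have "T_ABDF2 (Suc t) \<omega> c = (if \<theta> 0 = -1 \<or> (act (-1) = 1 \<and> \<omega> (t, -1) = 1)
        \<or> (act 0 = 1 \<and> \<omega> (t, 0) = 0) then alt1 else alt0)"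
      using True unfolding T_ABDF2_def c by simp
    ultimately have "T_ABDF2 (Suc t) \<omega> c = (if ?b 0 then alt1 else alt0)"
      and "?b x = (?b 0 = even x)" by simp_all
    then show ?thesis
      using alt[of x] by (cases "?b 0"; cases "even x") (simp_all add: alt1_def alt0_def mod2_eq_if)
  qed
  show ?thesis unfolding bond_rep_def T_ABDF_def fst_conv snd_conv using 1 2 by blast
qed

lemma phi_bond:
  assumes "c \<in> Lambda" "\<omega> \<in> Omega"
  shows "\<exists>b. bond_rep b (phi_ABDF t \<omega> c)"
proof (induction t)
  case 0
  then show ?case using Lambda_bond[OF assms(1)] by simp
next
  case (Suc t)
  then obtain b where "bond_rep b (phi_ABDF t \<omega> c)" ..
  from bond_rep_T[OF this assms(2), of t] show ?case by auto
qed

section \<open>Moving particles, collisions and creations in terms of bonds\<close>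

lemma MA_plus_bond:
  "bond_rep b c \<Longrightarrow> z \<in> MA_plus c \<omega> t \<longleftrightarrow> \<not> b (z + 1) \<and> (b z \<longrightarrow> \<omega> (t, z) = 0)"
  by (auto simp: bond_rep_def MA_plus_def M_plus_def A_set_def)

lemma MA_minus_bond:
  "bond_rep b c \<Longrightarrow> z \<in> MA_minus c \<omega> t \<longleftrightarrow> b z \<and> (\<not> b (z + 1) \<longrightarrow> \<omega> (t, z) = 0)"
  by (auto simp: bond_rep_def MA_minus_def M_minus_def A_set_def)

text \<open>Entering bond \<open>n\<close> from \<open>n - 1\<close> as a positive particle requires
  bit 0 there, entering it from \<open>n\<close> as a negative one requires bit 1.\<close>

lemma bond_exclusion:
  assumes "bond_rep b c"
  shows "\<not> (n - 1 \<in> MA_plus c \<omega> t \<and> n \<in> MA_minus c \<omega> t)"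
  using assms by (auto simp: MA_plus_bond MA_minus_bond)

text \<open>Everything is decided by the four bonds and three noise values around \<open>n\<close>.
  The first two claims glue the field at the next integer time; the third keeps creations apart from
  arriving particles.\<close>

lemma site_alternatives:
  fixes t t' :: nat
  assumes b: "bond_rep b c" and \<omega>: "\<omega> \<in> Omega"
  defines "c' \<equiv> T_ABDF (Suc t) \<omega> c"
  shows "n \<in> M_plus c' \<longleftrightarrow> n - 1 \<in> MA_plus_iso c \<omega> t"
    and "n \<in> M_minus c' \<longleftrightarrow> n + 1 \<in> MA_minus_iso c \<omega> t"
    and "n \<in> A_set c' \<omega> t' \<Longrightarrow> n - 1 \<notin> MA_plus c \<omega> t \<and> n + 1 \<notin> MA_minus c \<omega> t"
proof -
  let ?b = "bond_step (\<lambda>x. \<omega> (t, x)) b"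
  have b': "bond_rep ?b c'" unfolding c'_def using bond_rep_T[OF b \<omega>] .
  have om: "\<omega> (t, x) = 0 \<or> \<omega> (t, x) = 1" for x
    using \<omega> by (auto simp: Omega_def)
  note d = MA_plus_bond[OF b] MA_minus_bond[OF b] MA_plus_iso_def MA_minus_iso_def C_set_def
    M_plus_def M_minus_def A_set_def
  have th: "fst c' n = (if ?b n = ?b (n + 1) then if ?b n then -1 else 1 else 0)"
    and ac: "snd c' n = of_bool (?b n \<and> \<not> ?b (n + 1))"
    using b' by (auto simp: bond_rep_def)
  have bits: "P" if "\<And>b1 b2 b3 b4 e1 e2 e3. b (n - 1) = b1 \<Longrightarrow> b n = b2 \<Longrightarrow> b (n + 1) = b3 \<Longrightarrow> b (n + 1 + 1) = b4 \<Longrightarrow>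
      e1 = 0 \<or> e1 = 1 \<Longrightarrow> e2 = 0 \<or> e2 = 1 \<Longrightarrow> e3 = 0 \<or> e3 = 1 \<Longrightarrow>
      \<omega> (t, n - 1) = e1 \<Longrightarrow> \<omega> (t, n) = e2 \<Longrightarrow> \<omega> (t, n + 1) = e3 \<Longrightarrow> P" for P
    using that om by blast
  show "n \<in> M_plus c' \<longleftrightarrow> n - 1 \<in> MA_plus_iso c \<omega> t"
    unfolding d mem_Collect_eq th bond_step_def
    by (rule bits; elim disjE; simp)
  show "n \<in> M_minus c' \<longleftrightarrow> n + 1 \<in> MA_minus_iso c \<omega> t"
    unfolding d mem_Collect_eq th bond_step_def
    by (rule bits; elim disjE; simp)
  have "n \<in> A_set c' \<omega> t' \<longrightarrow> n - 1 \<notin> MA_plus c \<omega> t \<and> n + 1 \<notin> MA_minus c \<omega> t"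
    unfolding d mem_Collect_eq ac bond_step_def
    by (rule bits; elim disjE; simp)
  then show "n \<in> A_set c' \<omega> t' \<Longrightarrow> n - 1 \<notin> MA_plus c \<omega> t \<and> n + 1 \<notin> MA_minus c \<omega> t" ..
qed

subsection \<open>Transport of fronts\<close>

text \<open>The strict inequality is chosen so that the indicator of a moving interval, closed on
  the left and open on the right, is a difference of two fronts.\<close>

definition front :: "real \<Rightarrow> real \<Rightarrow> real \<Rightarrow> real \<Rightarrow> real" where
  "front p v t x = of_bool (x < p + v * t)"

lemma borel_measurable_front [measurable]: "front p v t \<in> borel_measurable borel"
  unfolding front_def by measurable

lemma integrable_front_mult:
  assumes "integrable lborel f"
  shows "integrable lborel (\<lambda>x. front p v t x * f x)"
proof (rule Bochner_Integration.integrable_bound[OF assms])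
  show "(\<lambda>x. front p v t x * f x) \<in> borel_measurable lborel"
    using assms by (intro borel_measurable_times) auto
qed (auto simp: front_def)

lemma integrable_continuous_bounded_support:
  fixes f :: "real \<Rightarrow> real"
  assumes "continuous_on UNIV f" "\<And>x. x \<notin> {-R..R} \<Longrightarrow> f x = 0"
  shows "integrable lborel f"
proof -
  have "integrable lborel (\<lambda>x. indicator {-R..R} x *\<^sub>R f x)"
    using assms(1) by (intro borel_integrable_compact) (auto intro: continuous_on_subset)
  also have "(\<lambda>x. indicator {-R..R} x *\<^sub>R f x) = f"
    using assms(2) by (fastforce simp: indicator_def)
  finally show ?thesis .
qed

text \<open>Dominated convergence: the integrands converge at every point except the limiting front
  position, which is a null set.\<close>

lemma continuous_integral_front:
  assumes f: "integrable lborel f"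
  shows "continuous_on S (\<lambda>t. LINT x|lborel. front p v t x * f x)"
proof (rule continuous_on_sequentiallyI)
  fix s and a :: real assume "s \<longlonglongrightarrow> a"
  then have s: "(\<lambda>n. p + v * s n) \<longlonglongrightarrow> p + v * a"
    by (intro tendsto_intros)
  have lim: "(\<lambda>n. front p v (s n) x * f x) \<longlonglongrightarrow> front p v a x * f x" if "x \<noteq> p + v * a" for x
  proof (rule tendsto_mult_right, rule tendsto_eventually)
    show "\<forall>\<^sub>F n in sequentially. front p v (s n) x = front p v a x"
    proof (cases "x < p + v * a")
      case True
      from order_tendstoD(1)[OF s True] show ?thesis
        by eventually_elim (use True in \<open>auto simp: front_def\<close>)
    next
      case False
      then have "p + v * a < x" using that by simp
      from order_tendstoD(2)[OF s this] show ?thesis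
        by eventually_elim (use False in \<open>auto simp: front_def\<close>)
    qed
  qed
  show "(\<lambda>n. LINT x|lborel. front p v (s n) x * f x) \<longlonglongrightarrow> (LINT x|lborel. front p v a x * f x)"
  proof (rule integral_dominated_convergence[where w = "\<lambda>x. norm (f x)"])
    show "AE x in lborel. (\<lambda>n. front p v (s n) x * f x) \<longlonglongrightarrow> front p v a x * f x"
      using AE_lborel_singleton[of "p + v * a"] by eventually_elim (rule lim)
    show "AE x in lborel. norm (front p v (s i) x * f x) \<le> norm (f x)" for i
      by (auto simp: front_def)
  qed (use integrable_front_mult[OF f] f in \<open>auto dest: borel_measurable_integrable\<close>)
qed

section \<open>Calculus of a test function\<close>

text \<open>One radius \<open>R\<close> bounds time and space, so on a slab the field has to be
  resolved into fronts only for \<open>x\<close> in \<open>{-R..R}\<close>.\<close>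

locale test_function =
  fixes g :: "real \<times> real \<Rightarrow> real" and R :: real
  assumes C1: "Ck 1 g"
    and vanish: "\<And>z. z \<notin> {-R..R} \<times> {-R..R} \<Longrightarrow> g z = 0"
begin

text \<open>Directional Frechet derivatives are used because \<open>Ck\<close> states continuity for
  exactly these; \<open>deriv_t\<close> and \<open>deriv_x\<close> recover the partial
  derivatives.\<close>

definition gt :: "real \<times> real \<Rightarrow> real" where "gt z = frechet_derivative g (at z) (1, 0)"
definition gx :: "real \<times> real \<Rightarrow> real" where "gx z = frechet_derivative g (at z) (0, 1)"

lemma has_derivative: "(g has_derivative frechet_derivative g (at z)) (at z)"
  using C1 by (simp only: One_nat_def Ck.simps flip: frechet_derivative_works)

lemma continuous_g: "continuous_on UNIV g"
  using C1 by (auto intro!: continuous_at_imp_continuous_on differentiable_imp_continuous_within)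

lemma continuous_gt: "continuous_on UNIV gt" and continuous_gx: "continuous_on UNIV gx"
  using C1 by (auto simp: gt_def[abs_def] gx_def[abs_def])

text \<open>The complement of the box is open, so \<open>g\<close> vanishes in a whole neighbourhood
  of \<open>z\<close>.\<close>

lemma vanish_derivatives:
  assumes "z \<notin> {-R..R} \<times> {-R..R}"
  shows "gt z = 0" "gx z = 0"
proof -
  let ?U = "- ({-R..R} \<times> {-R..R})"
  have "open ?U" by (intro open_Compl closed_Times closed_atLeastAtMost)
  then have "((\<lambda>_. 0) has_derivative (\<lambda>_. 0)) (at z)"
    and "(g has_derivative (\<lambda>_. 0)) (at z)"
    using assms vanish
    by (force intro!: has_derivative_transform_within_open[of "\<lambda>_. 0" "\<lambda>_. 0" z UNIV ?U g])+
  then have "frechet_derivative g (at z) = (\<lambda>_. 0)"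
    using frechet_derivative_at by metis
  then show "gt z = 0" "gx z = 0" by (auto simp: gt_def gx_def)
qed

lemma frechet_line: "frechet_derivative g (at z) (1, v) = gt z + v * gx z"
proof -
  interpret linear "frechet_derivative g (at z)"
    using has_derivative by (rule has_derivative_linear)
  have "(1, v) = (1, 0) + v *\<^sub>R (0, 1::real)" by simp
  then show ?thesis unfolding gt_def gx_def by (metis add scaleR real_scaleR_def)
qed

text \<open>Chain rule along the path of a front; speed 0 gives the time derivative.\<close>

lemma deriv_line: "((\<lambda>t. g (t, y + v * t)) has_vector_derivative
    gt (t, y + v * t) + v * gx (t, y + v * t)) (at t within S)"
proof -
  have "((\<lambda>t. (t, y + v * t)) has_derivative (\<lambda>h. (h, v * h))) (at t within S)"
    by (auto intro!: derivative_eq_intros)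
  from has_derivative_compose[OF this has_derivative]
  have "((\<lambda>t. g (t, y + v * t)) has_derivative
      (\<lambda>h. frechet_derivative g (at (t, y + v * t)) (h, v * h))) (at t within S)" .
  moreover have "frechet_derivative g (at z) (h, v * h) = h *\<^sub>R (gt z + v * gx z)" for z h
  proof -
    interpret linear "frechet_derivative g (at z)"
      using has_derivative by (rule has_derivative_linear)
    have "(h, v * h) = h *\<^sub>R (1, v)" by (simp add: mult.commute)
    then show ?thesis using scale frechet_line by metis
  qed
  ultimately show ?thesis by (simp add: has_vector_derivative_def)
qed

lemma deriv_t: "deriv (\<lambda>s. g (s, x)) t = gt (t, x)"
  using deriv_line[of x 0 t UNIV]
  by (auto intro!: DERIV_imp_deriv simp: has_real_derivative_iff_has_vector_derivative)

lemma deriv_x: "deriv (\<lambda>y. g (t, y)) x = gx (t, x)"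
proof -
  have "((\<lambda>y. (t, y)) has_derivative (\<lambda>h. (0, h))) (at x)"
    by (auto intro!: derivative_eq_intros)
  from has_derivative_compose[OF this has_derivative]
  have "((\<lambda>y. g (t, y)) has_derivative (\<lambda>h. frechet_derivative g (at (t, x)) (0, h))) (at x)" .
  moreover have "frechet_derivative g (at z) (0, h) = gx z * h" for z h
  proof -
    interpret linear "frechet_derivative g (at z)"
      using has_derivative by (rule has_derivative_linear)
    have "(0, h) = h *\<^sub>R (0::real, 1::real)" by simp
    then show ?thesis unfolding gx_def using scale by (metis mult.commute real_scaleR_def)
  qed
  ultimately show ?thesis by (auto intro!: DERIV_imp_deriv simp: has_field_derivative_def)
qed

lemma continuous_slice:
  assumes "continuous_on UNIV h"
  shows "continuous_on UNIV (\<lambda>x. h (t::real, x::real))"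
  by (rule continuous_on_compose2[OF assms]) (auto intro!: continuous_on_Pair continuous_intros)

lemma integrable_slices:
  "integrable lborel (\<lambda>x. g (t, x))" "integrable lborel (\<lambda>x. gt (t, x))"
  "integrable lborel (\<lambda>x. gx (t, x))"
  using continuous_g continuous_gt continuous_gx vanish vanish_derivatives
  by (auto intro!: integrable_continuous_bounded_support[where R = R] continuous_slice)

text \<open>In the frame moving with the front the domain of integration is fixed, so Fubini and the
  fundamental theorem of calculus suffice.\<close>

lemma front_transport:
  fixes p v :: real
  assumes "\<alpha> \<le> \<beta>"
  defines "W \<equiv> \<lambda>t. LINT x|lborel. front p v t x * (gt (t, x) + v * gx (t, x))"
  shows "set_integrable lborel {\<alpha>..\<beta>} W"
    and "(LINT t:{\<alpha>..\<beta>}|lborel. W t) =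
      (LINT x|lborel. front p v \<beta> x * g (\<beta>, x)) - (LINT x|lborel. front p v \<alpha> x * g (\<alpha>, x))"
proof -
  define k where "k t y = gt (t, y + v * t) + v * gx (t, y + v * t)" for t y
  \<comment> \<open>The shift \<open>v * t\<close> is at most the second summand in absolute value
    on the slab, so this radius contains the support in the moving frame.\<close>
  define R' where "R' = \<bar>R\<bar> + \<bar>v\<bar> * (\<bar>\<alpha>\<bar> + \<bar>\<beta>\<bar>)"
  define f where "f t y = indicator {\<alpha>..\<beta>} t * (of_bool (y < p) * k t y)" for t y
  have shift: "(LINT x|lborel. front p v t x * h x) = (LINT y|lborel. of_bool (y < p) * h (y + v * t))" for t h
  proof -
    have "(LINT x|lborel. front p v t x * h x) = (LINT y|lborel. front p v t (v * t + 1 * y) * h (v * t + 1 * y))"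
      by (subst lborel_integral_real_affine[of 1 _ "v * t"]) auto
    also have "\<dots> = (LINT y|lborel. of_bool (y < p) * h (y + v * t))"
      by (intro Bochner_Integration.integral_cong) (auto simp: front_def algebra_simps)
    finally show ?thesis .
  qed
  have contk: "continuous_on UNIV (\<lambda>z. k (fst z) (snd z))"
    unfolding k_def
    by (intro continuous_intros continuous_on_compose2[OF continuous_gt]
        continuous_on_compose2[OF continuous_gx]) auto
  have k0: "k t y = 0" if "t \<in> {\<alpha>..\<beta>}" "y \<notin> {-R'..R'}" for t y
  proof -
    have "\<bar>t\<bar> \<le> \<bar>\<alpha>\<bar> + \<bar>\<beta>\<bar>" using that(1) by auto
    then have "\<bar>v * t\<bar> \<le> \<bar>v\<bar> * (\<bar>\<alpha>\<bar> + \<bar>\<beta>\<bar>)" by (simp add: abs_mult mult_left_mono)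
    then have "y + v * t \<notin> {-R..R}" using that(2) unfolding R'_def by auto
    then show ?thesis unfolding k_def using vanish_derivatives by auto
  qed
  \<comment> \<open>Joint integrability for Fubini: a continuous function on a compact rectangle,
    cut off by the half-plane \<open>y < p\<close>.\<close>
  have "integrable lborel (\<lambda>z. indicator ({\<alpha>..\<beta>} \<times> {-R'..R'}) z *\<^sub>R k (fst z) (snd z))"
    using contk by (intro borel_integrable_compact compact_Times) (auto intro: continuous_on_subset)
  from integrable_mult_indicator[OF _ this, of "UNIV \<times> {..<p}"]
  have "integrable lborel (\<lambda>z. indicator (UNIV \<times> {..<p}) z *\<^sub>R
      (indicator ({\<alpha>..\<beta>} \<times> {-R'..R'}) z *\<^sub>R k (fst z) (snd z)))"
    by (simp only: sets_lborel borel_open open_Times open_UNIV open_lessThan)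
  also have "(\<lambda>z. indicator (UNIV \<times> {..<p}) z *\<^sub>R
      (indicator ({\<alpha>..\<beta>} \<times> {-R'..R'}) z *\<^sub>R k (fst z) (snd z))) = case_prod f"
    using k0 by (force simp: f_def indicator_def fun_eq_iff)
  finally have int: "integrable (lborel \<Otimes>\<^sub>M lborel) (case_prod f)" by (simp add: lborel_prod)
  have W: "indicator {\<alpha>..\<beta>} t *\<^sub>R W t = (LINT y|lborel. f t y)" for t
    unfolding W_def shift f_def k_def by simp
  show "set_integrable lborel {\<alpha>..\<beta>} W"
    unfolding set_integrable_def W using lborel_pair.integrable_fst'[OF int] by simp
  have i: "integrable lborel (\<lambda>y. of_bool (y < p) * g (t, y + v * t))" for t
  proof -
    have "integrable lborel (\<lambda>y. front p v t (v * t + 1 * y) * g (t, v * t + 1 * y))"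
      by (intro lborel_integrable_real_affine integrable_front_mult integrable_slices) auto
    then show ?thesis by (simp add: front_def algebra_simps)
  qed
  have "(LINT t:{\<alpha>..\<beta>}|lborel. W t) = (LINT t|lborel. LINT y|lborel. f t y)"
    unfolding set_lebesgue_integral_def W ..
  also have "\<dots> = (LINT y|lborel. LINT t|lborel. f t y)"
    using lborel_pair.Fubini_integral[OF int] by simp
  also have "\<dots> = (LINT y|lborel. of_bool (y < p) * g (\<beta>, y + v * \<beta>) - of_bool (y < p) * g (\<alpha>, y + v * \<alpha>))"
  proof (intro Bochner_Integration.integral_cong refl)
    fix y
    have "(LINT t|lborel. indicator {\<alpha>..\<beta>} t *\<^sub>R k t y) = g (\<beta>, y + v * \<beta>) - g (\<alpha>, y + v * \<alpha>)"
    proof (rule integral_FTC_atLeastAtMost[OF assms(1)])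
      show "((\<lambda>t. g (t, y + v * t)) has_vector_derivative k t y) (at t within {\<alpha>..\<beta>})" for t
        unfolding k_def by (rule deriv_line)
      show "continuous_on {\<alpha>..\<beta>} (\<lambda>t. k t y)"
        using continuous_on_compose2[OF contk, of "{\<alpha>..\<beta>}" "\<lambda>t. (t, y)"]
        by (simp add: continuous_on_Pair)
    qed
    moreover have "(LINT t|lborel. f t y) = of_bool (y < p) * (LINT t|lborel. indicator {\<alpha>..\<beta>} t *\<^sub>R k t y)"
      unfolding f_def by (cases "y < p") auto
    ultimately show "(LINT t|lborel. f t y) =
        of_bool (y < p) * g (\<beta>, y + v * \<beta>) - of_bool (y < p) * g (\<alpha>, y + v * \<alpha>)"
      by (simp add: algebra_simps)
  qed
  also have "\<dots> = (LINT x|lborel. front p v \<beta> x * g (\<beta>, x)) - (LINT x|lborel. front p v \<alpha> x * g (\<alpha>, x))"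
    unfolding shift using i by (simp add: Bochner_Integration.integral_diff)
  finally show "(LINT t:{\<alpha>..\<beta>}|lborel. W t) =
      (LINT x|lborel. front p v \<beta> x * g (\<beta>, x)) - (LINT x|lborel. front p v \<alpha> x * g (\<alpha>, x))" .
qed

end

text \<open>The second identity is the Rankine-Hugoniot condition. The indices \<open>(n, i)\<close> are the
  \<open>i\<close>-th front of the \<open>n\<close>-th cell.\<close>

definition front_sum :: "real \<Rightarrow> real \<Rightarrow> real \<Rightarrow> (real \<Rightarrow> real \<Rightarrow> real) \<Rightarrow> bool" where
  "front_sum \<alpha> \<beta> R u \<longleftrightarrow> (\<exists>(I :: (int \<times> nat) set) w p v. finite I \<and>
     (\<forall>t\<in>{\<alpha>..\<beta>}. \<forall>x\<in>{-R..R}.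
        u t x = (\<Sum>i\<in>I. w i * front (p i) (v i) t x) \<and>
        1/2 * (u t x)\<^sup>2 = (\<Sum>i\<in>I. w i * v i * front (p i) (v i) t x)))"

section \<open>Fields that are finite sums of fronts\<close>

text \<open>As \<open>f\<close> vanishes outside the window, the expansion inside it suffices, and
  the integral becomes a finite sum over single fronts.\<close>

lemma front_sum_continuous:
  assumes u: "front_sum \<alpha> \<beta> R u" and f: "integrable lborel f" "\<And>x. x \<notin> {-R..R} \<Longrightarrow> f x = 0"
  shows "continuous_on {\<alpha>..\<beta>} (\<lambda>t. LINT x|lborel. u t x * f x)"
proof -
  obtain I :: "(int \<times> nat) set" and w p v where I: "finite I"
    and ut: "\<And>t x. t \<in> {\<alpha>..\<beta>} \<Longrightarrow> x \<in> {-R..R} \<Longrightarrow> u t x = (\<Sum>i\<in>I. w i * front (p i) (v i) t x)"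
    using u unfolding front_sum_def by blast
  have "u t x * f x = (\<Sum>i\<in>I. w i * (front (p i) (v i) t x * f x))" if "t \<in> {\<alpha>..\<beta>}" for t x
    using ut[OF that, of x] f(2)[of x]
    by (cases "x \<in> {-R..R}") (auto simp: sum_distrib_right mult.assoc)
  then have "(LINT x|lborel. u t x * f x) =
      (\<Sum>i\<in>I. w i * (LINT x|lborel. front (p i) (v i) t x * f x))" if "t \<in> {\<alpha>..\<beta>}" for t
    using that integrable_front_mult[OF f(1)] by (simp add: Bochner_Integration.integral_sum)
  moreover have "continuous_on {\<alpha>..\<beta>} (\<lambda>t. \<Sum>i\<in>I. w i * (LINT x|lborel. front (p i) (v i) t x * f x))"
    by (intro continuous_intros continuous_integral_front f(1))
  ultimately show ?thesis by (metis (no_types, lifting) continuous_on_cong)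
qed

text \<open>Supplies a Borel function for each slab and window, to be glued over countably many such
  pieces.\<close>

lemma front_sum_measurable:
  assumes "front_sum \<alpha> \<beta> R u"
  shows "\<exists>h \<in> borel_measurable borel. \<forall>z \<in> {\<alpha>..\<beta>} \<times> {-R..R}. (case z of (t, x) \<Rightarrow> u t x) = h z"
proof -
  obtain I :: "(int \<times> nat) set" and w p v where I: "finite I"
    and ut: "\<And>t x. t \<in> {\<alpha>..\<beta>} \<Longrightarrow> x \<in> {-R..R} \<Longrightarrow> u t x = (\<Sum>i\<in>I. w i * front (p i) (v i) t x)"
    using assms unfolding front_sum_def by blast
  have "(\<lambda>z. \<Sum>i\<in>I. w i * front (p i) (v i) (fst z) (snd z)) \<in> borel_measurable (borel \<Otimes>\<^sub>M borel)"
    unfolding front_def by measurable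
  then have "(\<lambda>z. \<Sum>i\<in>I. w i * front (p i) (v i) (fst z) (snd z)) \<in> borel_measurable borel"
    by (simp add: borel_prod)
  then show ?thesis by (rule rev_bexI) (auto simp: ut)
qed

context test_function
begin

definition burgers_integrand :: "(real \<Rightarrow> real \<Rightarrow> real) \<Rightarrow> real \<Rightarrow> real" where
  "burgers_integrand u t = (LINT x|lborel. u t x * gt (t, x) + 1/2 * (u t x)\<^sup>2 * gx (t, x))"

text \<open>The two expansions share their fronts, with weights \<open>w\<close> and
  \<open>w * v\<close>, so the integrand pairs each front with \<open>gt + v * gx\<close>, the
  derivative of \<open>g\<close> along that front. Transport of single fronts then adds up.\<close>

lemma front_sum_transport:
  assumes u: "front_sum \<alpha> \<beta> R u" and "\<alpha> \<le> \<beta>"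
  shows "set_integrable lborel {\<alpha>..\<beta>} (burgers_integrand u)"
    and "(LINT t:{\<alpha>..\<beta>}|lborel. burgers_integrand u t) =
      (LINT x|lborel. u \<beta> x * g (\<beta>, x)) - (LINT x|lborel. u \<alpha> x * g (\<alpha>, x))"
proof -
  obtain I :: "(int \<times> nat) set" and w p v where I: "finite I"
    and ut: "\<And>t x. t \<in> {\<alpha>..\<beta>} \<Longrightarrow> x \<in> {-R..R} \<Longrightarrow> u t x = (\<Sum>i\<in>I. w i * front (p i) (v i) t x)"
    and u2: "\<And>t x. t \<in> {\<alpha>..\<beta>} \<Longrightarrow> x \<in> {-R..R} \<Longrightarrow>
      1/2 * (u t x)\<^sup>2 = (\<Sum>i\<in>I. w i * v i * front (p i) (v i) t x)"
    using u unfolding front_sum_def by blast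
  define W where "W i t = (LINT x|lborel. front (p i) (v i) t x * (gt (t, x) + v i * gx (t, x)))" for i t
  define G where "G i t = (LINT x|lborel. front (p i) (v i) t x * g (t, x))" for i t
  have "u t x * gt (t, x) + 1/2 * (u t x)\<^sup>2 * gx (t, x) =
      (\<Sum>i\<in>I. w i * (front (p i) (v i) t x * (gt (t, x) + v i * gx (t, x))))" if "t \<in> {\<alpha>..\<beta>}" for t x
  proof (cases "x \<in> {-R..R}")
    case True
    have "u t x * gt (t, x) + 1/2 * (u t x)\<^sup>2 * gx (t, x) =
        (\<Sum>i\<in>I. w i * front (p i) (v i) t x) * gt (t, x) + (\<Sum>i\<in>I. w i * v i * front (p i) (v i) t x) * gx (t, x)"
      using u2[OF that True] ut[OF that True] by metis
    also have "\<dots> = (\<Sum>i\<in>I. w i * (front (p i) (v i) t x * (gt (t, x) + v i * gx (t, x))))"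
      unfolding sum_distrib_right sum.distrib[symmetric]
      by (rule sum.cong) (auto simp: algebra_simps)
    finally show ?thesis .
  next
    case False
    then show ?thesis using vanish_derivatives[of "(t, x)"] by auto
  qed
  then have W: "burgers_integrand u t = (\<Sum>i\<in>I. w i * W i t)" if "t \<in> {\<alpha>..\<beta>}" for t
    using that integrable_slices unfolding W_def burgers_integrand_def
    by (simp add: Bochner_Integration.integral_sum integrable_front_mult)
  have "u t x * g (t, x) = (\<Sum>i\<in>I. w i * (front (p i) (v i) t x * g (t, x)))" if "t \<in> {\<alpha>..\<beta>}" for t x
    using ut[OF that, of x] vanish[of "(t, x)"]
    by (cases "x \<in> {-R..R}") (auto simp: sum_distrib_right mult.assoc)
  then have G: "(LINT x|lborel. u t x * g (t, x)) = (\<Sum>i\<in>I. w i * G i t)" if "t \<in> {\<alpha>..\<beta>}" for t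
    using that integrable_slices unfolding G_def
    by (simp add: Bochner_Integration.integral_sum integrable_front_mult)
  have tr: "set_integrable lborel {\<alpha>..\<beta>} (W i)" "(LINT t:{\<alpha>..\<beta>}|lborel. W i t) = G i \<beta> - G i \<alpha>" for i
    unfolding W_def G_def using front_transport[OF assms(2)] by blast+
  have int: "set_integrable lborel {\<alpha>..\<beta>} (\<lambda>t. \<Sum>i\<in>I. w i * W i t)"
    using tr(1) unfolding set_integrable_def
    by (simp add: sum_distrib_left mult.left_commute)
  then show "set_integrable lborel {\<alpha>..\<beta>} (burgers_integrand u)"
    using W by (subst set_integrable_cong[OF refl refl]) auto
  have "(LINT t:{\<alpha>..\<beta>}|lborel. burgers_integrand u t) = (LINT t:{\<alpha>..\<beta>}|lborel. \<Sum>i\<in>I. w i * W i t)"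
    using W by (intro set_lebesgue_integral_cong) auto
  also have "\<dots> = (\<Sum>i\<in>I. w i * (G i \<beta> - G i \<alpha>))"
  proof -
    have "(LINT t:{\<alpha>..\<beta>}|lborel. \<Sum>i\<in>I. w i * W i t) =
        (\<Sum>i\<in>I. w i * (LINT t:{\<alpha>..\<beta>}|lborel. W i t))"
      using tr(1) unfolding set_integrable_def set_lebesgue_integral_def
      by (simp add: sum_distrib_left mult.left_commute Bochner_Integration.integral_sum)
    then show ?thesis by (simp add: tr(2))
  qed
  also have "\<dots> = (\<Sum>i\<in>I. w i * G i \<beta>) - (\<Sum>i\<in>I. w i * G i \<alpha>)"
    by (simp add: algebra_simps sum_subtractf)
  finally show "(LINT t:{\<alpha>..\<beta>}|lborel. burgers_integrand u t) =
      (LINT x|lborel. u \<beta> x * g (\<beta>, x)) - (LINT x|lborel. u \<alpha> x * g (\<alpha>, x))"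
    using G assms(2) by simp
qed

text \<open>Neighbouring slabs overlap in one instant, a null set, and the boundary terms there
  cancel, because they are expressed by \<open>u\<close> itself and not by the fronts of either
  slab.\<close>

lemma slabs_transport:
  fixes u :: "real \<Rightarrow> real \<Rightarrow> real"
  assumes "\<And>k::nat. front_sum (real k/2) ((real k+1)/2) R u"
  shows "set_integrable lborel {0..real K/2} (burgers_integrand u) \<and>
    (LINT t:{0..real K/2}|lborel. burgers_integrand u t) =
      (LINT x|lborel. u (K/2) x * g (K/2, x)) - (LINT x|lborel. u 0 x * g (0, x))"
proof (induction K)
  case 0
  have "AE t in lborel. t \<notin> {0::real}" using AE_lborel_singleton[of "0::real"] by simp
  then have "(LINT t:{0::real}|lborel. burgers_integrand u t) = 0"
    unfolding set_lebesgue_integral_def by (intro integral_eq_zero_AE) (auto elim: eventually_mono)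
  moreover have "set_integrable lborel {0::real} (burgers_integrand u)"
    by simp
  ultimately show ?case by simp
next
  case (Suc K)
  let ?a = "real K/2" and ?b = "(real K+1)/2"
  have U: "{0..real (Suc K)/2} = {0..?a} \<union> {?a..?b}" by auto
  note s = front_sum_transport[OF assms[of K]]
  have i: "set_integrable lborel {?a..?b} (burgers_integrand u)" using s(1) by (simp add: add.commute)
  have "AE t in lborel. \<not> (t \<in> {0..?a} \<and> t \<in> {?a..?b})"
    using AE_lborel_singleton[of ?a] by eventually_elim auto
  then have "(LINT t:{0..?a} \<union> {?a..?b}|lborel. burgers_integrand u t) =
      (LINT t:{0..?a}|lborel. burgers_integrand u t) + (LINT t:{?a..?b}|lborel. burgers_integrand u t)"
    using Suc i by (intro set_integral_Un_AE) auto
  moreover have "set_integrable lborel ({0..?a} \<union> {?a..?b}) (burgers_integrand u)"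
    using Suc i by (intro set_integrable_Un) auto
  ultimately show ?case
    unfolding U using Suc s(2) by (simp add: add.commute)
qed

end

section \<open>From slabs to weak solutions\<close>

lemma compact_subset_box:
  fixes S :: "(real \<times> real) set"
  assumes "compact S"
  shows "\<exists>R. S \<subseteq> {-R..R} \<times> {-R..R}"
proof -
  obtain B where B: "\<And>z. z \<in> S \<Longrightarrow> norm z \<le> B"
    using compact_imp_bounded[OF assms] unfolding bounded_iff by blast
  have "\<bar>fst z\<bar> \<le> B" "\<bar>snd z\<bar> \<le> B" if "z \<in> S" for z
    using B[OF that] norm_fst_le[of "fst z" "snd z"] norm_snd_le[of "snd z" "fst z"] by auto
  then show ?thesis by (intro exI[of _ B]) force
qed

lemma supp_zero: "x \<notin> supp f \<Longrightarrow> f x = 0"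
  using closure_subset[of "{x. f x \<noteq> 0}"] by (auto simp: supp_def)

text \<open>The window \<open>R\<close> is universally quantified because the finite family of
  fronts depends on it; each test function and each piece of the measurability argument selects its
  own.\<close>

lemma weak_solution_front_sums:
  fixes u :: "real \<Rightarrow> real \<Rightarrow> real"
  assumes fs: "\<And>R (k::nat). front_sum (real k/2) ((real k+1)/2) R u"
    and bd: "\<And>t x. 0 \<le> t \<Longrightarrow> \<bar>u t x\<bar> \<le> B" and "T > 0"
  shows "weak_solution 0 T u"
  unfolding weak_solution_def
proof (intro conjI allI impI)
  \<comment> \<open>Slabs last half a time unit, so the first \<open>K\<close> of them cover
    \<open>{0..T}\<close>.\<close>
  obtain K :: nat where K: "2 * T \<le> real K" using real_arch_simple by blast
  have slab: "\<exists>k::nat. t \<in> {real k/2..(real k+1)/2}" if "0 \<le> t" for t :: real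
    using that by (intro exI[of _ "nat \<lfloor>2*t\<rfloor>"]) (simp, linarith)
  show "bounded ((\<lambda>(t, x). u t x) ` ({0..T} \<times> UNIV))"
    unfolding bounded_iff using bd by (intro exI[of _ B]) auto
  show "(\<lambda>(t, x). u t x) \<in> borel_measurable (restrict_space borel ({0..T} \<times> UNIV))"
  proof -
    \<comment> \<open>Negative times, where \<open>u\<close> is unconstrained, are filled with 0, so
      that measurability can be shown on the whole plane and then restricted.\<close>
    define U where "U = (\<lambda>(t, x). if 0 \<le> t then u t x else 0)"
    \<comment> \<open>\<open>n\<close> encodes a pair: \<open>k = 0\<close> is the region of
      negative times, and \<open>k > 0\<close> is slab \<open>k - 1\<close> with space window
      \<open>N\<close>.\<close>
    define S where "S n = (case prod_decode n of (k, N) \<Rightarrow>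
       if k = 0 then {..<0} \<times> UNIV
       else {real (k - 1)/2..(real (k - 1) + 1)/2} \<times> {-real N..real N})" for n
    have "U \<in> borel_measurable borel"
    proof (rule measurable_piecewise_restrict2[where A = S])
      show "S n \<in> sets borel" for n
      proof (cases "fst (prod_decode n) = 0")
        case True
        then have "open (S n)" by (auto simp: S_def split: prod.split intro!: open_Times)
        then show ?thesis by (rule borel_open)
      next
        case False
        then have "closed (S n)" by (auto simp: S_def split: prod.split intro!: closed_Times)
        then show ?thesis by (rule borel_closed)
      qed
      have "\<exists>n. (t, x) \<in> S n" for t x
      proof (cases "t < 0")
        case True
        then show ?thesis by (intro exI[of _ "prod_encode (0, 0)"]) (simp add: S_def)
      next
        case False
        then obtain k :: nat where k: "t \<in> {real k/2..(real k+1)/2}" using slab[of t] by auto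
        obtain N :: nat where "\<bar>x\<bar> \<le> real N" using real_arch_simple by blast
        then show ?thesis using k by (intro exI[of _ "prod_encode (Suc k, N)"]) (auto simp: S_def)
      qed
      then show "space borel = (\<Union>n. S n)" by auto
      show "\<exists>h \<in> borel_measurable borel. \<forall>z \<in> S n. U z = h z" for n
      proof -
        obtain k N where n: "prod_decode n = (k, N)" by (cases "prod_decode n")
        show ?thesis
        proof (cases k)
          case 0
          then show ?thesis by (intro bexI[of _ "\<lambda>_. 0"]) (auto simp: S_def n U_def)
        next
          case (Suc m)
          obtain h where h: "h \<in> borel_measurable borel"
            "\<And>z. z \<in> {real m/2..(real m+1)/2} \<times> {-real N..real N} \<Longrightarrow> (case z of (t, x) \<Rightarrow> u t x) = h z"
            using front_sum_measurable[OF fs[of m "real N"]] by blast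
          have "0 \<le> t" if "real m / 2 \<le> t" for t using that by (smt (verit) divide_nonneg_nonneg of_nat_0_le_iff)
          then have "\<forall>z \<in> S n. U z = h z" using h(2) by (force simp: S_def n Suc U_def)
          then show ?thesis using h(1) by blast
        qed
      qed
    qed
    then have "U \<in> borel_measurable (restrict_space borel ({0..T} \<times> UNIV))"
      by (rule measurable_restrict_space1)
    then show ?thesis
      by (rule measurable_cong[THEN iffD1, rotated]) (auto simp: U_def space_restrict_space)
  qed
  show "continuous_on {0..T} (\<lambda>t. LINT x|lborel. u t x * f x)"
    if f: "smooth f \<and> compact (supp f)" for f :: "real \<Rightarrow> real"
  proof -
    have "Ck 0 f" using f unfolding smooth_def by blast
    then have cont: "continuous_on UNIV f" by simp
    obtain R where R: "\<And>x. x \<in> supp f \<Longrightarrow> \<bar>x\<bar> \<le> R"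
      using f compact_imp_bounded[of "supp f"] unfolding bounded_iff real_norm_def by blast
    have f0: "f x = 0" if "x \<notin> {-R..R}" for x
      using that R[of x] supp_zero[of x f] by (cases "x \<in> supp f") (auto simp: abs_le_iff)
    have int: "integrable lborel f"
      using integrable_continuous_bounded_support[OF cont f0] .
    have "continuous_on {0..real k/2} (\<lambda>t. LINT x|lborel. u t x * f x)" for k :: nat
    proof (induction k)
      case (Suc k)
      have "{0..real (Suc k)/2} = {0..real k/2} \<union> {real k/2..(real k+1)/2}" by auto
      then show ?case
        using continuous_on_closed_Un[OF closed_atLeastAtMost closed_atLeastAtMost Suc
            front_sum_continuous[OF fs int f0]] by simp
    qed simp
    then show ?thesis by (rule continuous_on_subset[of "{0..real K/2}"]) (use K in auto)
  qed
  show "(LINT t:{0..T}|lborel. LINT x|lborel.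
      u t x * deriv (\<lambda>s. g (s, x)) t + 1/2 * (u t x)\<^sup>2 * deriv (\<lambda>y. g (t, y)) x) = 0"
    if g: "smooth g \<and> compact (supp g) \<and> supp g \<subseteq> {0<..<T} \<times> UNIV" for g :: "real \<times> real \<Rightarrow> real"
  proof -
    obtain R where R: "supp g \<subseteq> {-R..R} \<times> {-R..R}" using g compact_subset_box by blast
    have "Ck 1 g" using g unfolding smooth_def by blast
    moreover have "g z = 0" if "z \<notin> {-R..R} \<times> {-R..R}" for z
      using R that supp_zero by blast
    ultimately interpret test_function g R by unfold_locales
    have g0: "g (t, x) = 0" if "t \<le> 0 \<or> T \<le> t" for t x
      using g that by (intro supp_zero) auto
    \<comment> \<open>The slabs end at \<open>K/2\<close>, possibly after \<open>T\<close>; the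
      vanishing derivatives allow the time integral to be extended up to there.\<close>
    have d0: "gt (t, x) = 0" "gx (t, x) = 0" if "T < t" for t x
    proof -
      have "((\<lambda>_. 0) has_derivative (\<lambda>_. 0)) (at (t, x))" by simp
      then have "(g has_derivative (\<lambda>_. 0)) (at (t, x))"
        by (rule has_derivative_transform_within_open[of _ _ _ _ "{T<..} \<times> UNIV"])
          (use that g0 in \<open>auto intro: open_Times\<close>)
      then have "frechet_derivative g (at (t, x)) = (\<lambda>_. 0)"
        using frechet_derivative_at by metis
      then show "gt (t, x) = 0" "gx (t, x) = 0" by (simp_all add: gt_def gx_def)
    qed
    have "(LINT t:{0..T}|lborel. LINT x|lborel.
        u t x * deriv (\<lambda>s. g (s, x)) t + 1/2 * (u t x)\<^sup>2 * deriv (\<lambda>y. g (t, y)) x) =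
        (LINT t:{0..T}|lborel. burgers_integrand u t)"
      by (simp only: deriv_t deriv_x burgers_integrand_def)
    also have "\<dots> = (LINT t:{0..real K/2}|lborel. burgers_integrand u t)"
      unfolding set_lebesgue_integral_def
    proof (intro Bochner_Integration.integral_cong refl)
      show "indicator {0..T} t *\<^sub>R burgers_integrand u t = indicator {0..real K/2} t *\<^sub>R burgers_integrand u t" for t
        using K d0[of t] by (auto simp: indicator_def burgers_integrand_def not_le)
    qed
    also have "\<dots> = 0"
      using slabs_transport[OF fs, of K] g0[of "K/2"] g0[of 0] K by simp
    finally show ?thesis .
  qed
qed

subsection \<open>The field in a cell\<close>

text \<open>The fronts stay in the cell \<open>[a, a + 1)\<close>, and the vanishing sums make the field zero outside,
  so that fields on disjoint cells, and also their squares, can be added.\<close>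

definition cell_fronts :: "real \<Rightarrow> real \<Rightarrow> real \<Rightarrow> (real \<Rightarrow> real \<Rightarrow> real) \<Rightarrow> bool" where
  "cell_fronts \<alpha> \<beta> a u \<longleftrightarrow> (\<exists>w p v :: nat \<Rightarrow> real.
     (\<Sum>i<3. w i) = 0 \<and> (\<Sum>i<3. w i * v i) = 0 \<and>
     (\<forall>i<3. \<forall>t\<in>{\<alpha>..\<beta>}. p i + v i * t \<in> {a..a + 1}) \<and>
     (\<forall>t\<in>{\<alpha>..\<beta>}. \<forall>x\<in>{a..<a + 1}. \<bar>u t x\<bar> \<le> 2 \<and>
        u t x = (\<Sum>i<3. w i * front (p i) (v i) t x) \<and>
        1/2 * (u t x)\<^sup>2 = (\<Sum>i<3. w i * v i * front (p i) (v i) t x)))"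

text \<open>In cells left of the one containing \<open>x\<close> all fronts are 0 at
  \<open>x\<close>; in cells to its right all are 1 and the zero sums apply. Only the cell of
  \<open>x\<close> contributes, to the field and to its square. The offset \<kappa> serves two
  grids, that of bonds and that of sites.\<close>

lemma front_sum_cells:
  assumes "\<And>n::int. cell_fronts \<alpha> \<beta> (of_int n - \<kappa>) u"
  shows "front_sum \<alpha> \<beta> R u"
proof -
  define Q where "Q n w p v \<longleftrightarrow>
     (\<Sum>i<3. w i) = 0 \<and> (\<Sum>i<3. w i * v i) = 0 \<and>
     (\<forall>i<3. \<forall>t\<in>{\<alpha>..\<beta>}. p i + v i * t \<in> {of_int n - \<kappa>..of_int n - \<kappa> + 1}) \<and>
     (\<forall>t\<in>{\<alpha>..\<beta>}. \<forall>x\<in>{of_int n - \<kappa>..<of_int n - \<kappa> + 1}. \<bar>u t x\<bar> \<le> 2 \<and>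
        u t x = (\<Sum>i<3. w i * front (p i) (v i) t x) \<and>
        1/2 * (u t x)\<^sup>2 = (\<Sum>i<3. w i * v i * front (p i) (v i) t x))"
    for n :: int and w p v :: "nat \<Rightarrow> real"
  have "\<forall>n. \<exists>w p v. Q n w p v"
    using assms unfolding cell_fronts_def Q_def by (rule allI)
  then obtain w p v where Q: "\<And>n. Q n (w n) (p n) (v n)" by metis
  have w0: "(\<Sum>i<3. w n i) = 0" "(\<Sum>i<3. w n i * v n i) = 0" for n
    using Q[of n] unfolding Q_def by blast+
  have pos: "p n i + v n i * t \<in> {of_int n - \<kappa>..of_int n - \<kappa> + 1}"
    if "i < 3" "t \<in> {\<alpha>..\<beta>}" for n i t
    using Q[of n] that unfolding Q_def by blast
  have ut: "u t x = (\<Sum>i<3. w n i * front (p n i) (v n i) t x) \<and>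
      1/2 * (u t x)\<^sup>2 = (\<Sum>i<3. w n i * v n i * front (p n i) (v n i) t x)"
    if "t \<in> {\<alpha>..\<beta>}" "x \<in> {of_int n - \<kappa>..<of_int n - \<kappa> + 1}" for n t x
    using Q[of n] that unfolding Q_def by blast
  \<comment> \<open>The extra 1 absorbs the floor in the cell index \<open>m\<close>.\<close>
  define N where "N = \<lceil>\<bar>R\<bar> + \<bar>\<kappa>\<bar> + 1\<rceil>"
  have cell: "(\<Sum>(n, i)\<in>{-N..N} \<times> {..<3}. q n i * front (p n i) (v n i) t x) =
      (\<Sum>i<3. q m i * front (p m i) (v m i) t x)"
    if q0: "\<And>n. (\<Sum>i<3. q n i) = 0" and t: "t \<in> {\<alpha>..\<beta>}" and x: "x \<in> {-R..R}" and m: "m = \<lfloor>x + \<kappa>\<rfloor>"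
    for q t x m
  proof -
    let ?S = "\<lambda>n. \<Sum>i<3. q n i * front (p n i) (v n i) t x"
    have "?S n = 0" if "n \<noteq> m" for n
    proof (cases "n < m")
      case True
      then have "of_int n + 1 \<le> x + \<kappa>" unfolding m by linarith
      then have "front (p n i) (v n i) t x = 0" if "i < 3" for i
        using pos[OF that t, of n] by (auto simp: front_def)
      then show ?thesis by (intro sum.neutral) auto
    next
      case False
      then have "x + \<kappa> < of_int n" using that unfolding m by linarith
      then have "front (p n i) (v n i) t x = 1" if "i < 3" for i
        using pos[OF that t, of n] by (auto simp: front_def)
      then have "?S n = (\<Sum>i<3. q n i)" by (intro sum.cong) auto
      then show ?thesis using q0 by simp
    qed
    moreover have "m \<in> {-N..N}" using x unfolding m N_def by (simp, linarith)
    ultimately have "(\<Sum>n\<in>{-N..N}. ?S n) = ?S m"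
      by (subst sum.mono_neutral_right[of _ "{m}"]) auto
    then show ?thesis by (simp add: sum.cartesian_product)
  qed
  have main: "u t x = (\<Sum>i\<in>{-N..N} \<times> {..<3}. case_prod w i * front (case_prod p i) (case_prod v i) t x) \<and>
      1/2 * (u t x)\<^sup>2 = (\<Sum>i\<in>{-N..N} \<times> {..<3}. case_prod w i * case_prod v i * front (case_prod p i) (case_prod v i) t x)"
    if "t \<in> {\<alpha>..\<beta>}" "x \<in> {-R..R}" for t x
  proof -
    have "x \<in> {of_int \<lfloor>x + \<kappa>\<rfloor> - \<kappa>..<of_int \<lfloor>x + \<kappa>\<rfloor> - \<kappa> + 1}" by (simp, linarith)
    from ut[OF that(1) this] show ?thesis
      using cell[of w, OF w0(1) that refl] cell[of "\<lambda>n i. w n i * v n i", OF w0(2) that refl]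
      unfolding case_prod_unfold by (elim conjE) (intro conjI; erule trans; erule sym)
  qed
  show ?thesis unfolding front_sum_def
    by (intro exI[of _ "{-N..N} \<times> {..<3}"] exI[of _ "case_prod w"] exI[of _ "case_prod p"]
        exI[of _ "case_prod v"] conjI ballI main) (auto intro: main[THEN conjunct1] main[THEN conjunct2])
qed

text \<open>A collision or a creation uses three fronts, a single particle two; spare fronts get
  weight 0.\<close>

lemma cell_frontsI:
  fixes w0 w1 w2 p0 p1 p2 v0 v1 v2 :: real
  assumes "w0 + w1 + w2 = 0" "w0 * v0 + w1 * v1 + w2 * v2 = 0"
    and "\<And>t. t \<in> {\<alpha>..\<beta>} \<Longrightarrow> p0 + v0 * t \<in> {a..a + 1} \<and> p1 + v1 * t \<in> {a..a + 1} \<and> p2 + v2 * t \<in> {a..a + 1}"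
    and "\<And>t x. t \<in> {\<alpha>..\<beta>} \<Longrightarrow> x \<in> {a..<a + 1} \<Longrightarrow> \<bar>u t x\<bar> \<le> 2 \<and>
        u t x = w0 * front p0 v0 t x + w1 * front p1 v1 t x + w2 * front p2 v2 t x \<and>
        1/2 * (u t x)\<^sup>2 = w0 * v0 * front p0 v0 t x + w1 * v1 * front p1 v1 t x + w2 * v2 * front p2 v2 t x"
  shows "cell_fronts \<alpha> \<beta> a u"
proof -
  have less3: "(\<forall>i<3. P i) \<longleftrightarrow> P 0 \<and> P 1 \<and> P 2" for P :: "nat \<Rightarrow> bool"
    by (auto simp: less_Suc_eq numeral_3_eq_3 numeral_2_eq_2)
  have sum3: "(\<Sum>i<3. f i) = f 0 + f 1 + f 2" for f :: "nat \<Rightarrow> real"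
    by (simp add: numeral_3_eq_3 numeral_2_eq_2)
  have nth3: "[a, b, d] ! 0 = a" "[a, b, d] ! 1 = b" "[a, b, d] ! 2 = d" for a b d :: real
    by simp_all
  show ?thesis
    unfolding cell_fronts_def
    by (rule exI[of _ "\<lambda>i. [w0, w1, w2] ! i"], rule exI[of _ "\<lambda>i. [p0, p1, p2] ! i"],
        rule exI[of _ "\<lambda>i. [v0, v1, v2] ! i"], unfold less3 sum3 nth3) (use assms in blast)
qed

section \<open>The five local pictures\<close>

lemma cell_fronts_vacuum:
  assumes "\<And>t x. t \<in> {\<alpha>..\<beta>} \<Longrightarrow> x \<in> {a..<a + 1} \<Longrightarrow> u t x = 0"
  shows "cell_fronts \<alpha> \<beta> a u"
  by (rule cell_frontsI[of 0 0 0 0 0 0 _ _ a _ a a]) (use assms in auto)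

text \<open>Both edges separate the values 0 and 2, whose mean 1 is the speed. The spare front is
  parked at \<open>a\<close>.\<close>

lemma cell_fronts_right:
  assumes "a \<le> c + \<alpha>" "c + \<beta> + 1/2 \<le> a + 1"
    and "\<And>t x. t \<in> {\<alpha>..\<beta>} \<Longrightarrow> x \<in> {a..<a + 1} \<Longrightarrow> u t x = 2 * indicator {c + t..<c + t + 1/2} x"
  shows "cell_fronts \<alpha> \<beta> a u"
  by (rule cell_frontsI[of "-2" 2 0 1 1 0 _ _ c _ "c + 1/2" a])
    (use assms in \<open>auto simp: front_def indicator_def\<close>)

lemma cell_fronts_left:
  assumes "a \<le> c - \<beta> - 1/2" "c - \<alpha> \<le> a + 1"
    and "\<And>t x. t \<in> {\<alpha>..\<beta>} \<Longrightarrow> x \<in> {a..<a + 1} \<Longrightarrow> u t x = -2 * indicator {c - t - 1/2..<c - t} x"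
  shows "cell_fronts \<alpha> \<beta> a u"
  by (rule cell_frontsI[of "-2" 2 0 "-1" "-1" 0 _ _ c _ "c - 1/2" a])
    (use assms in \<open>auto simp: front_def indicator_def\<close>)

text \<open>The outer edges move inward and meet at time \<rho>. The jump from 2 to -2 at
  \<open>m\<close> stands still, since half the square is 2 on both sides.\<close>

lemma cell_fronts_collision:
  assumes "m = a + 1/2" "\<beta> \<le> \<rho>" "\<rho> \<le> \<alpha> + 1/2"
    and "\<And>t x. t \<in> {\<alpha>..\<beta>} \<Longrightarrow> x \<in> {a..<a + 1} \<Longrightarrow>
      u t x = 2 * (indicator {m - (\<rho> - t)..<m} x - indicator {m..<m + (\<rho> - t)} x)"
  shows "cell_fronts \<alpha> \<beta> a u"
  by (rule cell_frontsI[of "-2" 4 "-2" 1 0 "-1" _ _ "m - \<rho>" _ m "m + \<rho>"])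
    (use assms in \<open>auto simp: front_def indicator_def\<close>)

text \<open>Here \<sigma> is the time of birth. The jump from -2 to 2 at \<open>m\<close> satisfies
  the Rankine-Hugoniot condition with speed 0, although it violates the entropy condition.\<close>

lemma cell_fronts_creation:
  assumes "m = a + 1/2" "\<sigma> \<le> \<alpha>" "\<beta> \<le> \<sigma> + 1/2"
    and "\<And>t x. t \<in> {\<alpha>..\<beta>} \<Longrightarrow> x \<in> {a..<a + 1} \<Longrightarrow>
      u t x = 2 * (indicator {m..<m + (t - \<sigma>)} x - indicator {m - (t - \<sigma>)..<m} x)"
  shows "cell_fronts \<alpha> \<beta> a u"
  by (rule cell_frontsI[of 2 "-4" 2 "-1" 0 1 _ _ "m + \<sigma>" _ m "m - \<sigma>"])
    (use assms in \<open>auto simp: front_def indicator_def\<close>)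

section \<open>Localising the sums in a cell\<close>

lemma int_eqI:
  fixes m n :: int
  assumes "real_of_int m < real_of_int n + 1" "real_of_int n < real_of_int m + 1"
  shows "m = n"
proof -
  have "real_of_int m < real_of_int (n + 1)" "real_of_int n < real_of_int (m + 1)"
    using assms by simp_all
  then show ?thesis unfolding of_int_less_iff by simp
qed

text \<open>Reduces each infinite sum of the field to one conditional term, since at a point of a
  given cell at most one index is felt.\<close>

lemma infsum_at_most_one:
  fixes f :: "'a \<Rightarrow> real"
  assumes "\<And>z. z \<in> S \<Longrightarrow> z \<noteq> k \<Longrightarrow> f z = 0"
  shows "infsum f S = (if k \<in> S then f k else 0)"
proof -
  have "infsum f S = infsum f (S \<inter> {k})"
    by (rule infsum_cong_neutral) (use assms in auto)
  then show ?thesis by (cases "k \<in> S") auto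
qed

context
  fixes c :: config and \<omega> :: noise
begin

abbreviation "conf t0 \<equiv> phi_ABDF t0 \<omega> c"

text \<open>The cells are now the bonds: a particle is 1/2 wide and has moved by at most 1/2, so one
  seen in bond \<open>n\<close> started from \<open>n - 1\<close> rightwards or from
  \<open>n\<close> leftwards.\<close>

lemma u_first_half_cell:
  fixes n :: int
  assumes "t \<in> {real t0..real t0 + 1/2}" "x \<in> {of_int n - 1..<of_int n}"
  shows "u_first_half c \<omega> t0 t x =
    (if n - 1 \<in> MA_plus (conf t0) \<omega> t0
      then 2 * indicator {of_int n - 1 - t0 + t..<of_int n - 1 - t0 + t + 1/2} x else 0) -
    (if n \<in> MA_minus (conf t0) \<omega> t0
      then 2 * indicator {of_int n + t0 - t - 1/2..<of_int n + t0 - t} x else 0)"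
proof -
  let ?s = "t - real t0"
  have z: "z = n - 1" if "x \<in> {of_int z + ?s..<of_int z + ?s + 1/2}" for z :: int
    using that assms by (intro int_eqI) auto
  have z': "z = n" if "x \<in> {of_int z - ?s - 1/2..<of_int z - ?s}" for z :: int
    using that assms by (intro int_eqI) auto
  show ?thesis
    unfolding u_first_half_def Let_def
    by (subst infsum_at_most_one[of _ "n - 1"], use z in \<open>force simp: indicator_def\<close>,
        subst infsum_at_most_one[of _ n], use z' in \<open>force simp: indicator_def\<close>)
      (simp add: algebra_simps)
qed

text \<open>The cells are now centred at sites: particles heading for \<open>n\<close> have cleared
  the first half of their bond, and collisions and creations at \<open>n\<close> extend at most 1/2
  to either side.\<close>

lemma u_second_half_cell:
  fixes n :: int
  assumes "t \<in> {real t0 + 1/2..real t0 + 1}" "x \<in> {of_int n - 1/2..<of_int n + 1/2}"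
  shows "u_second_half c \<omega> t0 t x =
    (if n - 1 \<in> MA_plus_iso (conf t0) \<omega> t0
      then 2 * indicator {of_int n - 1 - t0 + t..<of_int n - 1 - t0 + t + 1/2} x else 0) -
    (if n + 1 \<in> MA_minus_iso (conf t0) \<omega> t0
      then 2 * indicator {of_int n + 1 + t0 - t - 1/2..<of_int n + 1 + t0 - t} x else 0) +
    (if n \<in> C_set (conf t0) \<omega> t0
      then 2 * (indicator {of_int n - (real t0 + 1 - t)..<of_int n} x
        - indicator {of_int n..<of_int n + (real t0 + 1 - t)} x) else 0) +
    (if n \<in> A_set (conf (t0 + 1)) \<omega> (t0 + 1)
      then 2 * (indicator {of_int n..<of_int n + (t - (real t0 + 1/2))} x
        - indicator {of_int n - (t - (real t0 + 1/2))..<of_int n} x) else 0)"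
proof -
  let ?s = "t - real t0" and ?r = "real t0 + 1 - t"
  have 1: "z = n - 1" if "x \<in> {of_int z + ?s..<of_int z + ?s + 1/2}" for z :: int
    using that assms by (intro int_eqI) auto
  have 2: "z = n + 1" if "x \<in> {of_int z - ?s - 1/2..<of_int z - ?s}" for z :: int
    using that assms by (intro int_eqI) auto
  have 3: "z = n" if "x \<in> {of_int z - ?r..<of_int z} \<or> x \<in> {of_int z..<of_int z + ?r}" for z :: int
    using that assms by (intro int_eqI) auto
  have 4: "z = n" if "x \<in> {of_int z..<of_int z + (?s - 1/2)} \<or> x \<in> {of_int z - (?s - 1/2)..<of_int z}" for z :: int
    using that assms by (intro int_eqI) auto
  show ?thesis
    unfolding u_second_half_def Let_def
    by (subst infsum_at_most_one[of _ "n - 1"], use 1 in \<open>force simp: indicator_def\<close>,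
        subst infsum_at_most_one[of _ "n + 1"], use 2 in \<open>force simp: indicator_def\<close>,
        subst infsum_at_most_one[of _ n], use 3 in \<open>force simp: indicator_def\<close>,
        subst infsum_at_most_one[of _ n], use 4 in \<open>force simp: indicator_def\<close>)
      (simp add: algebra_simps)
qed

lemma u_integer_time_cell:
  fixes n :: int
  assumes "x \<in> {of_int n - 1/2..<of_int n + 1/2}"
  shows "u_integer_time c \<omega> t0 x =
    (if n \<in> M_plus (conf t0) then 2 * indicator {of_int n..<of_int n + 1/2} x else 0) -
    (if n \<in> M_minus (conf t0) then 2 * indicator {of_int n - 1/2..<of_int n} x else 0) +
    (if n \<in> A_set (conf t0) \<omega> t0
      then 2 * (indicator {of_int n..<of_int n + 1/2} x - indicator {of_int n - 1/2..<of_int n} x) else 0)"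
proof -
  have z: "z = n" if "x \<in> {of_int z..<of_int z + 1/2} \<or> x \<in> {of_int z - 1/2..<of_int z}" for z :: int
    using that assms by (intro int_eqI) auto
  show ?thesis
    unfolding u_integer_time_def Let_def
    by (subst infsum_at_most_one[of _ n], use z in \<open>force simp: indicator_def\<close>,
        subst infsum_at_most_one[of _ n], use z in \<open>force simp: indicator_def\<close>,
        subst infsum_at_most_one[of _ n], use z in \<open>force simp: indicator_def\<close>)
      simp
qed

section \<open>The field along an orbit\<close>

context
  assumes c: "c \<in> Lambda" and \<omega>: "\<omega> \<in> Omega"
begin

lemma phi_alternatives:
  fixes n :: int
  shows "n \<in> M_plus (conf (t0 + 1)) \<longleftrightarrow> n - 1 \<in> MA_plus_iso (conf t0) \<omega> t0"
    and "n \<in> M_minus (conf (t0 + 1)) \<longleftrightarrow> n + 1 \<in> MA_minus_iso (conf t0) \<omega> t0"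
    and "n \<in> A_set (conf (t0 + 1)) \<omega> t1 \<Longrightarrow> n - 1 \<notin> MA_plus (conf t0) \<omega> t0 \<and> n + 1 \<notin> MA_minus (conf t0) \<omega> t0"
proof -
  obtain b where b: "bond_rep b (conf t0)" using phi_bond[OF c \<omega>] by blast
  note s = site_alternatives[OF b \<omega>]
  show "n \<in> M_plus (conf (t0 + 1)) \<longleftrightarrow> n - 1 \<in> MA_plus_iso (conf t0) \<omega> t0"
    and "n \<in> M_minus (conf (t0 + 1)) \<longleftrightarrow> n + 1 \<in> MA_minus_iso (conf t0) \<omega> t0"
    and "n \<in> A_set (conf (t0 + 1)) \<omega> t1 \<Longrightarrow> n - 1 \<notin> MA_plus (conf t0) \<omega> t0 \<and> n + 1 \<notin> MA_minus (conf t0) \<omega> t0"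
    using s[of n t0] s(3)[of n t0 t1] by simp_all
qed

text \<open>Reads the sets from the meeting site \<open>n\<close>, which makes the cases within one
  cell disjoint.\<close>

lemma iso_sites:
  fixes n :: int
  shows "n - 1 \<in> MA_plus_iso c' \<omega> t0 \<longleftrightarrow> n - 1 \<in> MA_plus c' \<omega> t0 \<and> n + 1 \<notin> MA_minus c' \<omega> t0"
    and "n + 1 \<in> MA_minus_iso c' \<omega> t0 \<longleftrightarrow> n - 1 \<notin> MA_plus c' \<omega> t0 \<and> n + 1 \<in> MA_minus c' \<omega> t0"
    and "n \<in> C_set c' \<omega> t0 \<longleftrightarrow> n - 1 \<in> MA_plus c' \<omega> t0 \<and> n + 1 \<in> MA_minus c' \<omega> t0"
proof -
  have e: "n - 1 + 1 = n" "n + 1 - 1 = n" by simp_all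
  show "n - 1 \<in> MA_plus_iso c' \<omega> t0 \<longleftrightarrow> n - 1 \<in> MA_plus c' \<omega> t0 \<and> n + 1 \<notin> MA_minus c' \<omega> t0"
    and "n + 1 \<in> MA_minus_iso c' \<omega> t0 \<longleftrightarrow> n - 1 \<notin> MA_plus c' \<omega> t0 \<and> n + 1 \<in> MA_minus c' \<omega> t0"
    and "n \<in> C_set c' \<omega> t0 \<longleftrightarrow> n - 1 \<in> MA_plus c' \<omega> t0 \<and> n + 1 \<in> MA_minus c' \<omega> t0"
    unfolding MA_plus_iso_def MA_minus_iso_def C_set_def mem_Collect_eq e by blast+
qed

text \<open>By bond exclusion a bond holds at most one particle, so nothing interacts before the
  half step.\<close>

lemma first_half_cell_fronts:
  fixes n :: int
  assumes u: "\<And>t x. t \<in> {real t0..real t0 + 1/2} \<Longrightarrow> u t x = u_first_half c \<omega> t0 t x"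
  shows "cell_fronts (real t0) (real t0 + 1/2) (of_int n - 1) u"
proof -
  obtain b where b: "bond_rep b (conf t0)" using phi_bond[OF c \<omega>] by blast
  note eq = u_first_half_cell[where n = n]
  consider "n - 1 \<in> MA_plus (conf t0) \<omega> t0" "n \<notin> MA_minus (conf t0) \<omega> t0"
    | "n - 1 \<notin> MA_plus (conf t0) \<omega> t0" "n \<in> MA_minus (conf t0) \<omega> t0"
    | "n - 1 \<notin> MA_plus (conf t0) \<omega> t0" "n \<notin> MA_minus (conf t0) \<omega> t0"
    using bond_exclusion[OF b] by blast
  then show ?thesis
  proof cases
    case 1
    \<comment> \<open>Fronts are parametrised by absolute time, so the constant is the position
      \<open>n - 1\<close> extrapolated back from time \<open>t0\<close> to time 0.\<close>
    then show ?thesis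
      by (intro cell_fronts_right[of _ "of_int n - 1 - t0"]) (simp_all add: u eq)
  next
    case 2
    then show ?thesis
      by (intro cell_fronts_left[of _ "of_int n + t0"]) (simp_all add: u eq)
  next
    case 3
    then show ?thesis
      by (intro cell_fronts_vacuum) (simp_all add: u eq)
  qed
qed

text \<open>A newly active site receives no particle, which leaves five combinations.\<close>

lemma second_half_cell_fronts:
  fixes n :: int
  assumes u: "\<And>t x. t \<in> {real t0 + 1/2..real t0 + 1} \<Longrightarrow> u t x = u_second_half c \<omega> t0 t x"
  shows "cell_fronts (real t0 + 1/2) (real t0 + 1) (of_int n - 1/2) u"
proof -
  note eq = u_second_half_cell[where n = n]
  let ?P = "n - 1 \<in> MA_plus (conf t0) \<omega> t0" and ?Q = "n + 1 \<in> MA_minus (conf t0) \<omega> t0"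
    and ?A = "n \<in> A_set (conf (t0 + 1)) \<omega> (t0 + 1)"
  consider "?P" "\<not> ?Q" "\<not> ?A" | "\<not> ?P" "?Q" "\<not> ?A" | "?P" "?Q" "\<not> ?A" | "\<not> ?P" "\<not> ?Q" "?A"
    | "\<not> ?P" "\<not> ?Q" "\<not> ?A"
    using phi_alternatives(3) by blast
  then show ?thesis
  proof cases
    case 1
    then show ?thesis
      by (intro cell_fronts_right[of _ "of_int n - 1 - t0"]) (simp_all add: u eq iso_sites)
  next
    case 2
    then show ?thesis
      by (intro cell_fronts_left[of _ "of_int n + 1 + t0"]) (simp_all add: u eq iso_sites)
  next
    case 3
    then show ?thesis
      by (intro cell_fronts_collision[of "of_int n" _ _ "real t0 + 1"]) (simp_all add: u eq iso_sites)
  next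
    case 4
    \<comment> \<open>The pair belongs to the configuration at \<open>t0 + 1\<close> but starts to
      grow half a step earlier.\<close>
    then show ?thesis
      by (intro cell_fronts_creation[of "of_int n" _ "real t0 + 1/2"]) (simp_all add: u eq iso_sites)
  next
    case 5
    then show ?thesis
      by (intro cell_fronts_vacuum) (simp_all add: u eq iso_sites)
  qed
qed

section \<open>Consistency of the overlapping rules\<close>

text \<open>Particle sites and active sites are disjoint, so the sums over \<open>MA_plus\<close>
  and \<open>MA_minus\<close> split; an active site contributes to both.\<close>

lemma first_half_at_integer:
  "u_first_half c \<omega> t0 (real t0) x = u_integer_time c \<omega> t0 x"
proof -
  define n where "n = \<lfloor>x + 1/2\<rfloor>"
  have x: "x \<in> {of_int n - 1/2..<of_int n + 1/2}" unfolding n_def by (simp, linarith)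
  have z: "z = n" if "x \<in> {of_int z..<of_int z + 1/2} \<or> x \<in> {of_int z - 1/2..<of_int z}" for z :: int
    using that x by (intro int_eqI) auto
  have "u_first_half c \<omega> t0 (real t0) x =
      (if n \<in> MA_plus (conf t0) \<omega> t0 then 2 * indicator {of_int n..<of_int n + 1/2} x else 0) -
      (if n \<in> MA_minus (conf t0) \<omega> t0 then 2 * indicator {of_int n - 1/2..<of_int n} x else 0)"
    unfolding u_first_half_def Let_def
    by (subst infsum_at_most_one[of _ n], use z in \<open>force simp: indicator_def\<close>,
        subst infsum_at_most_one[of _ n], use z in \<open>force simp: indicator_def\<close>) simp
  moreover obtain b where b: "bond_rep b (conf t0)" using phi_bond[OF c \<omega>] by blast
  have "n \<notin> M_plus (conf t0) \<inter> A_set (conf t0) \<omega> t0" "n \<notin> M_minus (conf t0) \<inter> A_set (conf t0) \<omega> t0"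
    using b by (auto simp: bond_rep_def M_plus_def M_minus_def A_set_def)
  ultimately show ?thesis
    unfolding u_integer_time_cell[OF x] MA_plus_def MA_minus_def
    by (cases "n \<in> A_set (conf t0) \<omega> t0") auto
qed

text \<open>At the end of the step collision intervals are empty, creation intervals have full width
  1/2, and isolated particles stand on \<open>M_plus\<close> and \<open>M_minus\<close> of the next
  configuration.\<close>

lemma second_half_at_integer:
  "u_second_half c \<omega> t0 (real t0 + 1) x = u_integer_time c \<omega> (t0 + 1) x"
proof -
  define n where "n = \<lfloor>x + 1/2\<rfloor>"
  have x: "x \<in> {of_int n - 1/2..<of_int n + 1/2}" unfolding n_def by (simp, linarith)
  have t: "real t0 + 1 \<in> {real t0 + 1/2..real t0 + 1}" by simp
  show ?thesis
    unfolding u_integer_time_cell[OF x] u_second_half_cell[OF t x] phi_alternatives(1,2)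
    by simp
qed

text \<open>At the half step creation intervals are empty, and a pair about to collide at
  \<open>n\<close> consists of two intervals of width 1/2 touching there. The first-half field is
  therefore evaluated around a site, not along a bond.\<close>

lemma halves_agree:
  "u_first_half c \<omega> t0 (real t0 + 1/2) x = u_second_half c \<omega> t0 (real t0 + 1/2) x"
proof -
  define n where "n = \<lfloor>x + 1/2\<rfloor>"
  have x: "x \<in> {of_int n - 1/2..<of_int n + 1/2}" unfolding n_def by (simp, linarith)
  have t: "real t0 + 1/2 \<in> {real t0 + 1/2..real t0 + 1}" by simp
  have z: "z = n - 1" if "x \<in> {of_int z + 1/2..<of_int z + 1/2 + 1/2}" for z :: int
    using that x by (intro int_eqI) auto
  have z': "z = n + 1" if "x \<in> {of_int z - 1/2 - 1/2..<of_int z - 1/2}" for z :: int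
    using that x by (intro int_eqI) auto
  have e: "real t0 + 1/2 - real t0 = 1/2" by simp
  have first: "u_first_half c \<omega> t0 (real t0 + 1/2) x =
      (if n - 1 \<in> MA_plus (conf t0) \<omega> t0 then 2 * indicator {of_int n - 1/2..<of_int n} x else 0) -
      (if n + 1 \<in> MA_minus (conf t0) \<omega> t0 then 2 * indicator {of_int n..<of_int n + 1/2} x else 0)"
    unfolding u_first_half_def Let_def e
    by (subst infsum_at_most_one[of _ "n - 1"], use z in \<open>force simp: indicator_def\<close>,
        subst infsum_at_most_one[of _ "n + 1"], use z' in \<open>force simp: indicator_def\<close>)
      (simp add: algebra_simps)
  let ?P = "n - 1 \<in> MA_plus (conf t0) \<omega> t0" and ?Q = "n + 1 \<in> MA_minus (conf t0) \<omega> t0"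
  show ?thesis
    unfolding first u_second_half_cell[OF t x] iso_sites
    by (cases ?P; cases ?Q) (simp_all add: algebra_simps)
qed

lemma field_exists: "\<exists>u. is_ABDF_field c \<omega> u"
proof -
  \<comment> \<open>At integer and half-integer times this prefers the first-half formula; agreement
    of the formulas there yields the other rules.\<close>
  define u where "u t x = (let t0 = nat \<lfloor>t\<rfloor> in
      if t \<le> real t0 + 1/2 then u_first_half c \<omega> t0 t x else u_second_half c \<omega> t0 t x)" for t x
  have first: "u t x = u_first_half c \<omega> t0 t x" if "t \<in> {real t0..real t0 + 1/2}" for t t0 x
  proof -
    have "\<lfloor>t\<rfloor> = int t0" using that by (intro floor_unique) auto
    then show ?thesis using that by (simp add: u_def)
  qed
  have integer: "u (real t0) x = u_integer_time c \<omega> t0 x" for t0 x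
    using first[of "real t0" t0] by (simp add: first_half_at_integer)
  have second: "u t x = u_second_half c \<omega> t0 t x" if t: "t \<in> {real t0 + 1/2..real t0 + 1}" for t t0 x
  proof -
    consider "t = real t0 + 1/2" | "t = real (t0 + 1)" | "real t0 + 1/2 < t" "t < real t0 + 1"
      using t by fastforce
    then show ?thesis
    proof cases
      case 1
      then show ?thesis using first[of t t0] halves_agree by simp
    next
      case 2
      then have "u t x = u_integer_time c \<omega> (t0 + 1) x" using integer by blast
      also have "\<dots> = u_second_half c \<omega> t0 (real t0 + 1) x" by (rule second_half_at_integer[symmetric])
      also have "real t0 + 1 = t" using 2 by simp
      finally show ?thesis .
    next
      case 3
      then have "\<lfloor>t\<rfloor> = int t0" by (intro floor_unique) auto
      then show ?thesis using 3 by (simp add: u_def)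
    qed
  qed
  show ?thesis unfolding is_ABDF_field_def using first second integer by blast
qed

section \<open>Assembling the weak solution\<close>

text \<open>Even slabs are first halves with cell offset 1, odd slabs are second halves with offset
  1/2. The bound 2 is read off in the cell containing \<open>x\<close>.\<close>

lemma field_weak_solution:
  assumes u: "is_ABDF_field c \<omega> u" and "T > 0"
  shows "weak_solution 0 T u"
proof -
  have first: "cell_fronts (real t0) (real t0 + 1/2) (of_int n - 1) u"
    and second: "cell_fronts (real t0 + 1/2) (real t0 + 1) (of_int n - 1/2) u" for n t0
    using u by (auto simp: is_ABDF_field_def intro!: first_half_cell_fronts second_half_cell_fronts)
  have slab: "\<exists>\<kappa>. \<forall>n::int. cell_fronts (real k/2) ((real k + 1)/2) (of_int n - \<kappa>) u" for k
  proof (cases "even k")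
    case True
    then obtain t0 where "k = 2 * t0" by blast
    then have "real k/2 = real t0" "(real k + 1)/2 = real t0 + 1/2" by simp_all
    then show ?thesis using first by metis
  next
    case False
    then obtain t0 where "k = 2 * t0 + 1" by (rule oddE)
    then have "real k/2 = real t0 + 1/2" "(real k + 1)/2 = real t0 + 1" by simp_all
    then show ?thesis using second by metis
  qed
  have "front_sum (real k/2) ((real k + 1)/2) R u" for k R
    using slab[of k] front_sum_cells by blast
  moreover have "\<bar>u t x\<bar> \<le> 2" if "0 \<le> t" for t x
  proof -
    define k where "k = nat \<lfloor>2 * t\<rfloor>"
    have t: "t \<in> {real k/2..(real k + 1)/2}" using that unfolding k_def by (simp, linarith)
    obtain \<kappa> where \<kappa>: "\<And>n::int. cell_fronts (real k/2) ((real k + 1)/2) (of_int n - \<kappa>) u"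
      using slab[of k] by blast
    have "x \<in> {of_int \<lfloor>x + \<kappa>\<rfloor> - \<kappa>..<of_int \<lfloor>x + \<kappa>\<rfloor> - \<kappa> + 1}" by (simp, linarith)
    then show ?thesis using \<kappa>[of "\<lfloor>x + \<kappa>\<rfloor>"] t unfolding cell_fronts_def by blast
  qed
  ultimately show ?thesis using \<open>T > 0\<close> by (rule weak_solution_front_sums)
qed

end

end

text \<open>Existence is asserted too, since the rules overlap at integer and half-integer times and
  contradictory rules would make the second claim vacuous.\<close>

theorem theorem23:
  fixes \<theta> act :: "int \<Rightarrow> int" and \<omega> :: noise
  assumes "(\<theta>, act) \<in> Lambda" and "\<omega> \<in> Omega"
  shows "(\<exists>u. is_ABDF_field (\<theta>, act) \<omega> u) \<and>
    (\<forall>u. is_ABDF_field (\<theta>, act) \<omega> u \<longrightarrow> (\<forall>T>0. weak_solution 0 T u))"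
  using field_exists[OF assms] field_weak_solution[OF assms] by blast

end
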